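(* Let $p_1$ and $p_2$ be fixed numbers such that $1>p_1>p_2>0$. Suppose that a random $3$-SAT formula with $n$ variables and $m_1=m_1(n)$ clauses is satisfiable with probability $\ge p_1$, and that a random $3$-SAT formula with $n$ variables and $m_2=m_2(n)$ clauses is satisfiable with probability $\le p_2$. Then $$m_2-m_1\ \ge\ (0.0015+o(1))\,(p_1-p_2)\,\sqrt{n},$$ where the $o(1)$ goes to $0$ when $n\to\infty$. In particular, the critical exponent satisfies $\nu_3\ge 2$ if it is well-defined. Similarly, for each fixed $k\ge 2$ there is a constant $a_k>0$, depending only on $k$, such that the following holds for all fixed $1>p_1>p_2>0$: if a random $k$-SAT formula with $n$ variables and $m_1=m_1(n)$ clauses is satisfiable with probability $\ge p_1$ and a random $k$-SAT formula with $n$ variables and $m_2=m_2(n)$ clauses is satisfiable with probability $\le p_2$, then $m_2-m_1\ge a_k\,(p_1-p_2)\sqrt{n}$ for all sufficiently large $n$. Consequently $\nu_k\ge 2$ if it is well-defined.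
   Context: A literal is a Boolean variable or its negation. A $k$-clause is the disjunction (OR) of $k$ literals whose underlying variables are all distinct; there are $2^k\binom{n}{k}$ possible $k$-clauses on $n$ variables. A random $k$-SAT formula with $n$ variables and $m$ clauses is the conjunction (AND) of $m$ uniformly random $k$-clauses on the $n$ variables; the result applies both when the $m$ clauses are selected uniformly at random without replacement and when they are selected uniformly at random with replacement (the same mode being used throughout). A formula is satisfiable if some assignment of truth values to the variables makes it TRUE. Critical exponent: for $0<r<1$ let $m_r(n)$ denote the smallest $m$ for which a random $k$-SAT formula with $n$ variables and $m$ clauses is satisfiable with probability $\le r$. For $0<\varepsilon<1/2$ the characteristic width of the satisfiability transition is $\Delta_\varepsilon(n)=m_\varepsilon(n)-m_{1-\varepsilon}(n)$, the amount by which $m$ must be increased for the probability of satisfiability to drop from $1-\varepsilon$ to $\varepsilon$. The exponent $\nu=\nu_k$ is well-defined if there is a number $\nu_k$, not depending on $\varepsilon$, with $\Delta_\varepsilon(n)=\Theta(n^{1-1/\nu_k})$ as $n\to\infty$ for each $\varepsilon$, where the constants hidden by $\Theta$ may depend on $\varepsilon$. *)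

theory Defs
  imports "HOL-Probability.Probability" "HOL-Library.Landau_Symbols"
begin

datatype literal = Literal (var: nat) (is_pos: bool)

type_synonym clause = "literal set"
type_synonym formula = "clause list"

text \<open>The \<open>n\<close> variables are \<open>0, \<dots>, n - 1\<close>.\<close>

definition k_clauses :: "nat \<Rightarrow> nat \<Rightarrow> clause set" where
  "k_clauses k n = {C. var ` C \<subseteq> {..<n} \<and> inj_on var C \<and> finite C \<and> card C = k}"

definition satisfies :: "(nat \<Rightarrow> bool) \<Rightarrow> formula \<Rightarrow> bool" where
  "satisfies A F \<longleftrightarrow> (\<forall>C\<in>set F. \<exists>l\<in>C. A (var l) = is_pos l)"

definition satisfiable :: "formula \<Rightarrow> bool" where
  "satisfiable F \<longleftrightarrow> (\<exists>A. satisfies A F)"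

datatype sampling = With_Replacement | Without_Replacement

text \<open>
  The possible outcomes of successively drawing \<open>m\<close> clauses. There may be none:
  without replacement at most \<open>2 ^ k * (n choose k)\<close> clauses can be drawn
  (see \<open>formulas_nonempty_iff\<close> below). As \<^const>\<open>pmf_of_set\<close> is unspecified on the empty set,
  nonemptiness of \<open>formulas s k n m\<close> accompanies every use of the random formula.
\<close>

fun formulas :: "sampling \<Rightarrow> nat \<Rightarrow> nat \<Rightarrow> nat \<Rightarrow> formula set" where
  "formulas With_Replacement k n m = {F. length F = m \<and> set F \<subseteq> k_clauses k n}"
| "formulas Without_Replacement k n m = {F. length F = m \<and> set F \<subseteq> k_clauses k n \<and> distinct F}"

definition random_formula :: "sampling \<Rightarrow> nat \<Rightarrow> nat \<Rightarrow> nat \<Rightarrow> formula pmf" where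
  "random_formula s k n m = pmf_of_set (formulas s k n m)"

definition sat_prob :: "sampling \<Rightarrow> nat \<Rightarrow> nat \<Rightarrow> nat \<Rightarrow> real" where
  "sat_prob s k n m = measure_pmf.prob (random_formula s k n m) {F. satisfiable F}"

definition threshold :: "sampling \<Rightarrow> nat \<Rightarrow> real \<Rightarrow> nat \<Rightarrow> nat" where
  "threshold s k r n = (LEAST m. formulas s k n m \<noteq> {} \<and> sat_prob s k n m \<le> r)"

definition transition_width :: "sampling \<Rightarrow> nat \<Rightarrow> real \<Rightarrow> nat \<Rightarrow> real" where
  "transition_width s k \<epsilon> n = real (threshold s k \<epsilon> n) - real (threshold s k (1 - \<epsilon>) n)"

text \<open>
  The exponent is well-defined iff some \<open>\<nu>\<close> satisfies the following predicate, and its value is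
  then that \<open>\<nu>\<close>. The condition \<open>\<nu> \<noteq> 0\<close> is needed because \<open>1 / 0 = 0\<close> in HOL.
\<close>

definition is_critical_exponent :: "sampling \<Rightarrow> nat \<Rightarrow> real \<Rightarrow> bool" where
  "is_critical_exponent s k \<nu> \<longleftrightarrow>
     \<nu> \<noteq> 0 \<and>
     (\<forall>\<epsilon>. 0 < \<epsilon> \<and> \<epsilon> < 1 / 2 \<longrightarrow> transition_width s k \<epsilon> \<in> \<Theta>(\<lambda>n. real n powr (1 - 1 / \<nu>)))"

lemma bij_betw_k_clauses:
  "bij_betw (\<lambda>(V, P). (\<lambda>v. Literal v (v \<in> P)) ` V)
     (SIGMA V:{V. V \<subseteq> {..<n} \<and> card V = k}. Pow V) (k_clauses k n)"
proof (rule bij_betwI[where g = "\<lambda>C. (var ` C, var ` {l\<in>C. is_pos l})"])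
  show "(\<lambda>(V, P). (\<lambda>v. Literal v (v \<in> P)) ` V)
      \<in> (SIGMA V:{V. V \<subseteq> {..<n} \<and> card V = k}. Pow V) \<rightarrow> k_clauses k n"
    by (auto simp: k_clauses_def inj_on_def card_image finite_subset)
next
  show "(\<lambda>C. (var ` C, var ` {l\<in>C. is_pos l}))
      \<in> k_clauses k n \<rightarrow> (SIGMA V:{V. V \<subseteq> {..<n} \<and> card V = k}. Pow V)"
    by (auto simp: k_clauses_def card_image)
next
  fix x assume "x \<in> (SIGMA V:{V. V \<subseteq> {..<n} \<and> card V = k}. Pow V)"
  then obtain V P where "x = (V, P)" "P \<subseteq> V" by auto
  moreover have "{l \<in> (\<lambda>v. Literal v (v \<in> P)) ` V. is_pos l} = (\<lambda>v. Literal v True) ` P"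
    using \<open>P \<subseteq> V\<close> by auto
  ultimately show "(\<lambda>C. (var ` C, var ` {l\<in>C. is_pos l}))
      ((\<lambda>(V, P). (\<lambda>v. Literal v (v \<in> P)) ` V) x) = x"
    by (simp add: image_image)
next
  fix C assume C: "C \<in> k_clauses k n"
  have "Literal (var l) (var l \<in> var ` {l\<in>C. is_pos l}) = l" if "l \<in> C" for l
  proof -
    have "var l \<in> var ` {l\<in>C. is_pos l} \<longleftrightarrow> is_pos l"
      using C that by (auto simp: k_clauses_def inj_on_def)
    thus ?thesis by simp
  qed
  hence "(\<lambda>l. Literal (var l) (var l \<in> var ` {l\<in>C. is_pos l})) ` C = (\<lambda>l. l) ` C"
    by (intro image_cong) auto
  thus "(\<lambda>(V, P). (\<lambda>v. Literal v (v \<in> P)) ` V)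
      ((\<lambda>C. (var ` C, var ` {l\<in>C. is_pos l})) C) = C"
    by (simp add: image_image)
qed

lemma finite_k_clauses: "finite (k_clauses k n)"
  and card_k_clauses: "card (k_clauses k n) = 2 ^ k * (n choose k)"
proof -
  let ?S = "{V. V \<subseteq> {..<n} \<and> card V = k}"
  have fin: "finite ?S" by (rule finite_subset[of _ "Pow {..<n}"]) auto
  have finV: "\<forall>V\<in>?S. finite (Pow V)"
    by (auto intro: finite_subset[OF _ finite_lessThan])
  have "finite (SIGMA V:?S. Pow V)" using fin finV by (intro finite_SigmaI) auto
  thus "finite (k_clauses k n)" using bij_betw_finite[OF bij_betw_k_clauses] by blast
  have "card (k_clauses k n) = card (SIGMA V:?S. Pow V)"
    by (rule bij_betw_same_card[OF bij_betw_k_clauses, symmetric])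
  also have "\<dots> = (\<Sum>V\<in>?S. card (Pow V))"
    by (rule card_SigmaI[OF fin finV])
  also have "\<dots> = (\<Sum>V\<in>?S. 2 ^ k)"
  proof (rule sum.cong)
    fix V assume "V \<in> ?S"
    hence "card V = k" "finite V" by (auto intro: finite_subset[OF _ finite_lessThan])
    thus "card (Pow V) = 2 ^ k" by (simp add: card_Pow)
  qed simp
  also have "\<dots> = 2 ^ k * card ?S" by simp
  also have "card ?S = n choose k" using n_subsets[of "{..<n}" k] by simp
  finally show "card (k_clauses k n) = 2 ^ k * (n choose k)" .
qed

lemma finite_formulas: "finite (formulas s k n m)"
proof -
  have "finite {F. set F \<subseteq> k_clauses k n \<and> length F = m}"
    using finite_k_clauses by (rule finite_lists_length_eq)
  thus ?thesis by (cases s) (auto elim: rev_finite_subset)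
qed

lemma formulas_nonempty_iff:
  "formulas With_Replacement k n m \<noteq> {} \<longleftrightarrow> m = 0 \<or> k \<le> n"
  "formulas Without_Replacement k n m \<noteq> {} \<longleftrightarrow> m \<le> 2 ^ k * (n choose k)"
proof -
  show "formulas With_Replacement k n m \<noteq> {} \<longleftrightarrow> m = 0 \<or> k \<le> n"
  proof (cases "k \<le> n")
    case True
    hence "card (k_clauses k n) \<noteq> 0" by (simp add: card_k_clauses)
    then obtain C where "C \<in> k_clauses k n" by fastforce
    hence "replicate m C \<in> formulas With_Replacement k n m" by auto
    thus ?thesis using True by blast
  next
    case False
    hence "k_clauses k n = {}"
      using card_k_clauses[of k n] card_0_eq[OF finite_k_clauses[of k n]] by simp
    thus ?thesis using False by auto
  qed
  show "formulas Without_Replacement k n m \<noteq> {} \<longleftrightarrow> m \<le> 2 ^ k * (n choose k)"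
  proof
    assume "formulas Without_Replacement k n m \<noteq> {}"
    then obtain F where "length F = m" "set F \<subseteq> k_clauses k n" "distinct F" by auto
    thus "m \<le> 2 ^ k * (n choose k)"
      by (metis card_k_clauses card_mono distinct_card finite_k_clauses)
  next
    assume m: "m \<le> 2 ^ k * (n choose k)"
    obtain G where G: "set G = k_clauses k n" "distinct G"
      using finite_distinct_list[OF finite_k_clauses] by blast
    hence "length G = 2 ^ k * (n choose k)"
      by (metis card_k_clauses distinct_card)
    hence "take m G \<in> formulas Without_Replacement k n m"
      using G m set_take_subset[of m G] by auto
    thus "formulas Without_Replacement k n m \<noteq> {}" by blast
  qed
qed

end

theory Submission
  imports Defs "HOL-Real_Asymp.Real_Asymp"
begin

text \<open>
  Call a clause of a formula \<open>F\<close> pure if one of its literals occurs nowhere negated in \<open>F\<close>. Pure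
  clauses are irrelevant for the satisfiability of any subformula. Draw \<open>m + x\<close> random clauses
  and let \<open>S\<close> be the indicator that the first \<open>m\<close> of them are satisfiable. The covariance of \<open>S\<close>
  with the difference between the fractions of pure clauses among the first \<open>m\<close> and the last \<open>x\<close>
  is evaluated in two ways. By Cauchy--Schwarz it is at most the standard deviation of that
  difference, which exchangeability shows to be \<open>O(1 / sqrt n)\<close>. On the other hand, exchanging a
  clause from each part and deleting it where it is pure shows that it equals the expected drop of
  satisfiability from \<open>m - 1\<close> to \<open>m\<close> clauses, weighted by the conditional probability that one
  further clause is pure. Since the number of missing literals is concentrated (occurrences of
  different literals are negatively correlated), this weight is bounded below. Hence the
  satisfiability probability drops by only \<open>O(1 / sqrt n)\<close> per clause, as long as \<open>m = O(n)\<close>;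
  the first moment bound excludes larger \<open>m\<close>.
\<close>

section \<open>Clauses and literals\<close>

definition negated :: "literal \<Rightarrow> literal" where
  "negated l = Literal (var l) (\<not> is_pos l)"

lemma var_negated [simp]: "var (negated l) = var l"
  and negated_negated [simp]: "negated (negated l) = l"
  and negated_neq [simp]: "negated l \<noteq> l"
  by (cases l; simp add: negated_def)+

lemma eq_negated_iff: "l' = negated l \<longleftrightarrow> var l' = var l \<and> l' \<noteq> l"
  by (cases l; cases l') (auto simp: negated_def)

lemma inj_negated: "inj_on negated A"
  by (metis inj_onI negated_negated)

lemma satisfiable_mono: "satisfiable F \<Longrightarrow> set G \<subseteq> set F \<Longrightarrow> satisfiable G"
  unfolding satisfiable_def satisfies_def by blast

lemma satisfiable_cong: "set F = set G \<Longrightarrow> satisfiable F = satisfiable G"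
  unfolding satisfiable_def satisfies_def by simp

text \<open>Making \<open>l\<close> true satisfies \<open>C\<close> and can only harm clauses that
  contain \<open>negated l\<close>, of which \<open>G\<close> has none.\<close>

lemma satisfiable_pure_clause:
  assumes "l \<in> C" "negated l \<notin> \<Union>(set G)"
  shows "satisfiable (C # G) \<longleftrightarrow> satisfiable G"
proof
  assume "satisfiable G"
  then obtain A where A: "satisfies A G" unfolding satisfiable_def by blast
  have "satisfies (A(var l := is_pos l)) (C # G)"
    unfolding satisfies_def
  proof
    fix D assume D: "D \<in> set (C # G)"
    show "\<exists>l'\<in>D. (A(var l := is_pos l)) (var l') = is_pos l'"
    proof (cases "D \<in> set G")
      case True
      then obtain l' where l': "l' \<in> D" "A (var l') = is_pos l'"
        using A unfolding satisfies_def by blast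
      have "l' \<noteq> negated l" using l' True assms(2) by blast
      thus ?thesis using l' unfolding eq_negated_iff by (intro bexI[of _ l']) auto
    next
      case False
      thus ?thesis using D assms(1) by auto
    qed
  qed
  thus "satisfiable (C # G)" unfolding satisfiable_def by blast
qed (auto intro: satisfiable_mono)

section \<open>Counting clauses with prescribed literals\<close>

definition clauses_on :: "nat set \<Rightarrow> nat \<Rightarrow> clause set" where
  "clauses_on V k = {C. var ` C \<subseteq> V \<and> inj_on var C \<and> finite C \<and> card C = k}"

lemma k_clauses_eq: "k_clauses k n = clauses_on {..<n} k"
  by (simp add: k_clauses_def clauses_on_def)

lemma finite_clauses_on:
  assumes "finite V"
  shows "finite (clauses_on V k)"
proof -
  obtain n where "V \<subseteq> {..<n}" using assms finite_nat_iff_bounded by blast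
  hence "clauses_on V k \<subseteq> k_clauses k n" by (auto simp: clauses_on_def k_clauses_def)
  thus ?thesis using finite_k_clauses finite_subset by blast
qed

text \<open>Deleting \<open>l\<close> takes its variable out of \<open>V\<close>, possibly from the
  middle; this is why clauses are counted over arbitrary variable sets rather than initial
  segments.\<close>

lemma bij_betw_remove_literal:
  assumes "var l \<in> V" "l \<notin> L"
  shows "bij_betw (\<lambda>C. C - {l}) {C \<in> clauses_on V (Suc k). insert l L \<subseteq> C}
           {C \<in> clauses_on (V - {var l}) k. L \<subseteq> C}"
proof (rule bij_betwI[where g = "insert l"])
  show "(\<lambda>C. C - {l}) \<in> {C \<in> clauses_on V (Suc k). insert l L \<subseteq> C} \<rightarrow>
          {C \<in> clauses_on (V - {var l}) k. L \<subseteq> C}"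
    using assms(2) by (auto simp: clauses_on_def inj_on_def)
  show "insert l \<in> {C \<in> clauses_on (V - {var l}) k. L \<subseteq> C} \<rightarrow>
          {C \<in> clauses_on V (Suc k). insert l L \<subseteq> C}"
    using assms(1) by (fastforce simp: clauses_on_def card_insert_if)
  show "C \<in> {C \<in> clauses_on (V - {var l}) k. L \<subseteq> C} \<Longrightarrow> insert l C - {l} = C" for C
    by (auto simp: clauses_on_def)
qed auto

lemma card_containing_literals:
  assumes "var l \<in> V" "l \<notin> L"
  shows "card {C \<in> clauses_on V (Suc k). insert l L \<subseteq> C} =
           card {C \<in> clauses_on (V - {var l}) k. L \<subseteq> C}"
  using bij_betw_remove_literal[OF assms] by (rule bij_betw_same_card)

text \<open>Pascal's rule: a clause on \<open>insert v V\<close> either avoids \<open>v\<close>, or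
  contains exactly one of its two literals and becomes a shorter clause on \<open>V\<close> once
  that literal is deleted.\<close>

lemma card_clauses_on:
  assumes "finite V"
  shows "card (clauses_on V k) = 2 ^ k * (card V choose k)"
  using assms
proof (induction V arbitrary: k rule: finite_induct)
  case empty
  have "clauses_on {} 0 = {{}}" by (auto simp: clauses_on_def)
  moreover have "clauses_on {} (Suc j) = {}" for j by (auto simp: clauses_on_def)
  ultimately show ?case by (cases k) auto
next
  case (insert v V)
  show ?case
  proof (cases k)
    case 0
    have "clauses_on (insert v V) 0 = {{}}" by (auto simp: clauses_on_def)
    thus ?thesis using 0 by simp
  next
    case (Suc j)
    let ?W = "insert v V"
    let ?P = "\<lambda>b. {C \<in> clauses_on ?W k. Literal v b \<in> C}"
    have fin: "finite (clauses_on U i)" if "U \<subseteq> ?W" for U i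
      using finite_clauses_on finite_subset[OF that] insert.hyps(1) by simp
    have P: "card (?P b) = 2 ^ j * (card V choose j)" for b
    proof -
      have "card (?P b) = card (clauses_on (?W - {v}) j)"
        unfolding Suc using card_containing_literals[of "Literal v b" ?W "{}" j] by simp
      also have "?W - {v} = V" using insert.hyps by auto
      finally show ?thesis using insert.IH by simp
    qed
    have 1: "clauses_on ?W k = clauses_on V k \<union> (?P True \<union> ?P False)"
    proof (intro equalityI subsetI)
      fix C assume C: "C \<in> clauses_on ?W k"
      show "C \<in> clauses_on V k \<union> (?P True \<union> ?P False)"
      proof (cases "\<exists>l\<in>C. var l = v")
        case True
        then obtain l where "l \<in> C" "l = Literal v (is_pos l)" by (metis literal.collapse)
        thus ?thesis using C by (cases "is_pos l") auto
      next
        case False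
        thus ?thesis using C by (auto simp: clauses_on_def)
      qed
    qed (auto simp: clauses_on_def)
    have 2: "?P True \<inter> ?P False = {}" by (fastforce simp: clauses_on_def inj_on_def)
    have 3: "clauses_on V k \<inter> (?P True \<union> ?P False) = {}"
      using insert.hyps(2) by (auto simp: clauses_on_def)
    have "card (clauses_on ?W k) = card (clauses_on V k) + (card (?P True) + card (?P False))"
      by (subst 1, subst card_Un_disjoint) (use fin 2 3 in \<open>auto intro!: card_Un_disjoint\<close>)
    also have "\<dots> = 2 ^ k * (card ?W choose k)"
      unfolding P insert.IH using Suc insert.hyps by (simp add: algebra_simps)
    finally show ?thesis .
  qed
qed

text \<open>By symmetry each of the \<open>2 * n\<close> literals lies in a share
  \<open>k / (2 * n)\<close> of the clauses; denominators are cleared to stay in \<open>nat\<close>.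
  The proof deletes \<open>l\<close> and applies the absorption identity for binomials.\<close>

lemma card_with_literal:
  assumes "var l < n" "k \<ge> 1"
  shows "2 * n * card {C \<in> k_clauses k n. l \<in> C} = k * card (k_clauses k n)"
proof -
  obtain j where j: "k = Suc j" using assms(2) by (cases k) auto
  obtain i where i: "n = Suc i" using assms(1) by (cases n) auto
  have "card {C \<in> k_clauses k n. l \<in> C} = card (clauses_on ({..<n} - {var l}) j)"
    unfolding j k_clauses_eq using card_containing_literals[of l "{..<n}" "{}" j] assms(1) by simp
  also have "\<dots> = 2 ^ j * (i choose j)" using assms(1) i by (simp add: card_clauses_on)
  finally have "2 * n * card {C \<in> k_clauses k n. l \<in> C} = 2 ^ k * (Suc i * (i choose j))"
    by (simp add: i j algebra_simps)
  also have "\<dots> = k * card (k_clauses k n)"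
    unfolding card_k_clauses i j
    by (subst Suc_times_binomial_eq[of i j]) (simp only: mult_ac)
  finally show ?thesis .
qed

lemma card_with_two_literals:
  assumes "var l < n" "var l' < n" "var l \<noteq> var l'" "k \<ge> 2"
  shows "4 * n * (n - 1) * card {C \<in> k_clauses k n. l \<in> C \<and> l' \<in> C} = k * (k - 1) * card (k_clauses k n)"
proof -
  obtain j where j: "k = Suc (Suc j)" using assms(4) by (metis add_2_eq_Suc le_Suc_ex)
  obtain i where i: "n = Suc (Suc i)"
    using assms(1-3) by (metis less_Suc0 less_one not0_implies_Suc not_less_zero)
  have "card {C \<in> k_clauses k n. l \<in> C \<and> l' \<in> C} =
          card {C \<in> clauses_on ({..<n} - {var l}) (Suc j). l' \<in> C}"
    unfolding j k_clauses_eq using card_containing_literals[of l "{..<n}" "{l'}" "Suc j"] assms(1,3)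
    by auto
  also have "\<dots> = card (clauses_on ({..<n} - {var l} - {var l'}) j)"
    using card_containing_literals[of l' "{..<n} - {var l}" "{}" j] assms(2,3) by auto
  also have "\<dots> = 2 ^ j * (i choose j)"
    using assms(1-3) i by (simp add: card_clauses_on card_Diff_singleton_if)
  finally have "4 * n * (n - 1) * card {C \<in> k_clauses k n. l \<in> C \<and> l' \<in> C} =
      2 ^ k * (Suc (Suc i) * (Suc i * (i choose j)))"
    by (simp add: i j algebra_simps)
  also have "\<dots> = 2 ^ k * (Suc j * (Suc (Suc i) * (Suc i choose Suc j)))"
    by (subst Suc_times_binomial_eq[of i j]) (simp only: mult_ac)
  also have "\<dots> = k * (k - 1) * card (k_clauses k n)"
    unfolding card_k_clauses i j diff_Suc_1
    by (subst Suc_times_binomial_eq[of "Suc i" "Suc j"]) (simp only: mult_ac)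
  finally show ?thesis .
qed

text \<open>No clause contains both literals if they share a variable or \<open>k = 1\<close>.
  Otherwise the two sides differ only by the factors \<open>(k - 1) / (n - 1)\<close> and
  \<open>k / n\<close>.\<close>

lemma two_literals_negatively_correlated:
  assumes "var l < n" "var l' < n" "l \<noteq> l'" "1 \<le> k" "k \<le> n"
  shows "card {C \<in> k_clauses k n. l \<in> C \<and> l' \<in> C} * card (k_clauses k n)
           \<le> card {C \<in> k_clauses k n. l \<in> C} * card {C \<in> k_clauses k n. l' \<in> C}"
proof (cases "var l = var l' \<or> k = 1")
  case True
  have "{C \<in> k_clauses k n. l \<in> C \<and> l' \<in> C} = {}"
  proof (rule ccontr)
    assume "{C \<in> k_clauses k n. l \<in> C \<and> l' \<in> C} \<noteq> {}"
    then obtain C where C: "C \<in> k_clauses k n" "l \<in> C" "l' \<in> C" by auto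
    hence "inj_on var C" "card C = k" by (simp_all add: k_clauses_def)
    hence "var l \<noteq> var l'" using C(2,3) assms(3) by (meson inj_onD)
    hence "k = 1" using True by simp
    thus False using C(2,3) assms(3) \<open>card C = k\<close> by (metis card_1_singletonE singletonD)
  qed
  thus ?thesis by (simp only: card.empty mult_0 le0)
next
  case False
  define t a b T where "t = real (card {C \<in> k_clauses k n. l \<in> C \<and> l' \<in> C})"
    and "a = real (card {C \<in> k_clauses k n. l \<in> C})"
    and "b = real (card {C \<in> k_clauses k n. l' \<in> C})"
    and "T = real (card (k_clauses k n))"
  have n: "n \<ge> 2" and k: "k \<ge> 2" using False assms by auto
  have a: "2 * real n * a = real k * T" "2 * real n * b = real k * T"
    using card_with_literal[OF assms(1,4), THEN arg_cong[where f = real]]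
      card_with_literal[OF assms(2,4), THEN arg_cong[where f = real]]
    unfolding a_def b_def T_def by (simp_all only: of_nat_mult of_nat_numeral)
  have nk: "real (n - 1) = real n - 1" "real (k - 1) = real k - 1" using n k by auto
  have t: "4 * real n * (real n - 1) * t = real k * (real k - 1) * T"
    using card_with_two_literals[of l n l' k, THEN arg_cong[where f = real]] False assms(1,2) k
    unfolding t_def T_def by (simp only: of_nat_mult of_nat_numeral nk) blast
  \<comment> \<open>A common denominator for both sides. After multiplication the claim reduces to
    \<open>n * (k - 1) \<le> k * (n - 1)\<close>, that is, to \<open>k \<le> n\<close>.\<close>
  define c where "c = (2 * real n) * (2 * real n) * (real n - 1)"
  have "c * (t * T) = real n * T * (4 * real n * (real n - 1) * t)"
    unfolding c_def by algebra
  also have "\<dots> = (n * (real k - 1)) * (k * T ^ 2)"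
    unfolding t by algebra
  also have "\<dots> \<le> (k * (real n - 1)) * (k * T ^ 2)"
  proof (rule mult_right_mono)
    show "n * (real k - 1) \<le> k * (real n - 1)" using assms(5) by (simp add: algebra_simps)
  qed simp
  also have "\<dots> = (real n - 1) * ((k * T) * (k * T))" by algebra
  also have "\<dots> = (real n - 1) * ((2 * real n * a) * (2 * real n * b))" by (simp only: a)
  also have "\<dots> = c * (a * b)" unfolding c_def by algebra
  finally have "c * (t * T) \<le> c * (a * b)" .
  moreover have "c > 0" using n by (simp add: c_def)
  ultimately have "t * T \<le> a * b" by simp
  thus ?thesis unfolding t_def T_def a_def b_def of_nat_mult[symmetric] of_nat_le_iff .
qed

section \<open>Exchangeability of random formulas\<close>

fun extensions :: "sampling \<Rightarrow> nat \<Rightarrow> nat \<Rightarrow> formula \<Rightarrow> clause set" where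
  "extensions With_Replacement k n F = k_clauses k n"
| "extensions Without_Replacement k n F = k_clauses k n - set F"

text \<open>Depends on the formula only through its length. Hence drawing clauses one at a time,
  each uniform among the extensions, yields the uniform distribution on
  \<open>formulas\<close>.\<close>

fun num_extensions :: "sampling \<Rightarrow> nat \<Rightarrow> nat \<Rightarrow> nat \<Rightarrow> nat" where
  "num_extensions With_Replacement k n m = card (k_clauses k n)"
| "num_extensions Without_Replacement k n m = card (k_clauses k n) - m"

lemma finite_extensions: "finite (extensions s k n F)"
  and extensions_subset: "extensions s k n F \<subseteq> k_clauses k n"
  by (cases s; simp add: finite_k_clauses)+

lemma num_extensions_le: "num_extensions s k n m \<le> card (k_clauses k n)"
  and num_extensions_ge: "card (k_clauses k n) - m \<le> num_extensions s k n m"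
  by (cases s; simp)+

lemma card_extensions:
  assumes "F \<in> formulas s k n m"
  shows "card (extensions s k n F) = num_extensions s k n m"
  using assms by (cases s) (auto simp: card_Diff_subset distinct_card)

text \<open>A formula that avoids \<open>X\<close> has used up none of it, so even without
  replacement all of \<open>X\<close> can still be drawn.\<close>

lemma card_extensions_avoiding:
  assumes "F \<in> formulas s k n m" "X \<subseteq> k_clauses k n" "set F \<inter> X = {}"
  shows "card (extensions s k n F - X) = num_extensions s k n m - card X"
    and "card X \<le> num_extensions s k n m"
proof -
  have "X \<subseteq> extensions s k n F" using assms by (cases s) auto
  thus "card (extensions s k n F - X) = num_extensions s k n m - card X"
      "card X \<le> num_extensions s k n m"
    using card_extensions[OF assms(1)] finite_extensions[of s k n F]
    by (metis card_Diff_subset finite_subset, metis card_mono)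
qed

lemma formulas_0 [simp]: "formulas s k n 0 = {[]}"
  by (cases s) auto

lemma length_formulas: "F \<in> formulas s k n m \<Longrightarrow> length F = m"
  and set_formulas: "F \<in> formulas s k n m \<Longrightarrow> set F \<subseteq> k_clauses k n"
  by (cases s; auto)+

text \<open>The new draw goes to the head of the list, so position \<open>0\<close> plays the part
  of the last draw and \<open>tl\<close> gives the earlier ones.\<close>

lemma formulas_Suc:
  "formulas s k n (Suc m) = (\<lambda>(F, C). C # F) ` (SIGMA F:formulas s k n m. extensions s k n F)"
proof (rule set_eqI)
  fix G show "G \<in> formulas s k n (Suc m) \<longleftrightarrow>
    G \<in> (\<lambda>(F, C). C # F) ` (SIGMA F:formulas s k n m. extensions s k n F)"
    by (cases s; cases G) (auto simp: image_iff)
qed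

lemma sum_formulas_Suc:
  "(\<Sum>F\<in>formulas s k n (Suc m). \<phi> F) =
     (\<Sum>F\<in>formulas s k n m. \<Sum>C\<in>extensions s k n F. \<phi> (C # F))"
proof -
  have "(\<Sum>F\<in>formulas s k n (Suc m). \<phi> F) =
      (\<Sum>(F, C)\<in>(SIGMA F:formulas s k n m. extensions s k n F). \<phi> (C # F))"
    unfolding formulas_Suc by (subst sum.reindex) (auto simp: inj_on_def intro!: sum.cong)
  thus ?thesis by (simp add: sum.Sigma finite_formulas finite_extensions)
qed

lemma card_formulas_Suc:
  "card (formulas s k n (Suc m)) = card (formulas s k n m) * num_extensions s k n m"
proof -
  have "card (formulas s k n (Suc m)) = (\<Sum>F\<in>formulas s k n m. card (extensions s k n F))"
    using sum_formulas_Suc[of "\<lambda>_. 1::nat" s k n m] by simp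
  thus ?thesis using card_extensions by simp
qed

lemma formulas_nonempty_Suc:
  assumes "formulas s k n (Suc m) \<noteq> {}"
  shows "formulas s k n m \<noteq> {}" "num_extensions s k n m > 0"
  using assms card_formulas_Suc[of s k n m] finite_formulas[of s k n]
  by (auto simp: card_gt_0_iff[symmetric])

lemma formulas_nonempty_le:
  "formulas s k n m \<noteq> {} \<Longrightarrow> i \<le> m \<Longrightarrow> formulas s k n i \<noteq> {}"
  by (induction m) (use formulas_nonempty_Suc(1) le_Suc_eq in blast)+

text \<open>Exchangeability: length, set of clauses and distinctness, which define
  \<open>formulas\<close> in either mode, survive a reordering.\<close>

lemma bij_betw_permute_formulas:
  assumes "\<pi> permutes {..<m}"
  shows "bij_betw (permute_list \<pi>) (formulas s k n m) (formulas s k n m)"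
proof (rule bij_betwI[where g = "permute_list (inv \<pi>)"])
  have *: "permute_list \<rho> \<in> formulas s k n m \<rightarrow> formulas s k n m" if "\<rho> permutes {..<m}" for \<rho>
    using that by (cases s) auto
  show "permute_list \<pi> \<in> formulas s k n m \<rightarrow> formulas s k n m"
    "permute_list (inv \<pi>) \<in> formulas s k n m \<rightarrow> formulas s k n m"
    using * assms permutes_inv by blast+
  fix F assume "F \<in> formulas s k n m"
  hence len: "length F = m" by (rule length_formulas)
  show "permute_list (inv \<pi>) (permute_list \<pi> F) = F"
    using permute_list_compose[of "inv \<pi>" F \<pi>] permutes_inv[OF assms] len permutes_inv_o[OF assms]
    by simp
  show "permute_list \<pi> (permute_list (inv \<pi>) F) = F"
    using permute_list_compose[of \<pi> F "inv \<pi>"] assms len permutes_inv_o[OF assms]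
    by simp
qed

section \<open>Averages over random formulas\<close>

definition mean :: "sampling \<Rightarrow> nat \<Rightarrow> nat \<Rightarrow> nat \<Rightarrow> (formula \<Rightarrow> real) \<Rightarrow> real" where
  "mean s k n m \<phi> = (\<Sum>F\<in>formulas s k n m. \<phi> F) / card (formulas s k n m)"

lemma mean_cong:
  "(\<And>F. F \<in> formulas s k n m \<Longrightarrow> \<phi> F = \<psi> F) \<Longrightarrow> mean s k n m \<phi> = mean s k n m \<psi>"
  unfolding mean_def by simp

lemma mean_mono:
  "(\<And>F. F \<in> formulas s k n m \<Longrightarrow> \<phi> F \<le> \<psi> F) \<Longrightarrow> mean s k n m \<phi> \<le> mean s k n m \<psi>"
  unfolding mean_def by (intro divide_right_mono sum_mono) auto

lemma mean_add: "mean s k n m (\<lambda>F. \<phi> F + \<psi> F) = mean s k n m \<phi> + mean s k n m \<psi>"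
  and mean_diff: "mean s k n m (\<lambda>F. \<phi> F - \<psi> F) = mean s k n m \<phi> - mean s k n m \<psi>"
  and mean_cmult: "mean s k n m (\<lambda>F. c * \<phi> F) = c * mean s k n m \<phi>"
  and mean_sum: "mean s k n m (\<lambda>F. \<Sum>i\<in>I. f i F) = (\<Sum>i\<in>I. mean s k n m (f i))"
  and mean_nonneg: "(\<And>F. F \<in> formulas s k n m \<Longrightarrow> 0 \<le> \<phi> F) \<Longrightarrow> 0 \<le> mean s k n m \<phi>"
proof -
  show "mean s k n m (\<lambda>F. \<Sum>i\<in>I. f i F) = (\<Sum>i\<in>I. mean s k n m (f i))"
    unfolding mean_def by (subst sum.swap) (simp add: sum_divide_distrib)
qed (auto simp: mean_def sum.distrib add_divide_distrib sum_subtractf diff_divide_distrib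
    sum_distrib_left intro!: sum_nonneg divide_nonneg_nonneg)

text \<open>Over an empty set of formulas every mean is \<open>0 / 0 = 0\<close>, so a constant is
  reproduced only when formulas exist.\<close>

lemma mean_const: "formulas s k n m \<noteq> {} \<Longrightarrow> mean s k n m (\<lambda>_. c) = c"
  unfolding mean_def using finite_formulas[of s k n m] by simp

lemma mean_permute:
  assumes "\<pi> permutes {..<m}"
  shows "mean s k n m (\<lambda>F. \<phi> (permute_list \<pi> F)) = mean s k n m \<phi>"
  unfolding mean_def using sum.reindex_bij_betw[OF bij_betw_permute_formulas[OF assms]] by metis

lemma mean_Suc:
  "mean s k n (Suc m) \<phi> =
     mean s k n m (\<lambda>F. (\<Sum>C\<in>extensions s k n F. \<phi> (C # F)) / num_extensions s k n m)"
  unfolding mean_def sum_formulas_Suc card_formulas_Suc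
  by (simp add: sum_divide_distrib[symmetric] mult.commute)

lemma mean_tl:
  assumes "formulas s k n (Suc m) \<noteq> {}"
  shows "mean s k n (Suc m) (\<lambda>F. \<phi> (tl F)) = mean s k n m \<phi>"
  unfolding mean_Suc
  by (rule mean_cong) (use formulas_nonempty_Suc[OF assms] card_extensions in simp)

lemma mean_take_Suc:
  assumes "formulas s k n (Suc m) \<noteq> {}"
  shows "mean s k n (Suc m) (\<lambda>F. \<phi> (take m F)) = mean s k n m \<phi>"
proof -
  \<comment> \<open>A cyclic shift: it moves the tail of \<open>F\<close> to the first
    \<open>m\<close> positions, which reduces the claim to \<open>mean_tl\<close>.\<close>
  define \<pi> where "\<pi> = (\<lambda>i. if i < Suc m then (if i = m then 0 else Suc i) else i)"
  have "bij_betw \<pi> {..<Suc m} {..<Suc m}"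
    by (rule bij_betwI[where g = "\<lambda>i. if i = 0 then m else i - 1"]) (auto simp: \<pi>_def)
  hence \<pi>: "\<pi> permutes {..<Suc m}"
    by (rule bij_imp_permutes) (auto simp: \<pi>_def)
  have "take m (permute_list \<pi> F) = tl F" if "F \<in> formulas s k n (Suc m)" for F
  proof (rule nth_equalityI)
    have len: "length F = Suc m" using that by (rule length_formulas)
    show "length (take m (permute_list \<pi> F)) = length (tl F)" using len by simp
    fix i assume "i < length (take m (permute_list \<pi> F))"
    thus "take m (permute_list \<pi> F) ! i = tl F ! i"
      using permute_list_nth[of \<pi> F i] \<pi> len by (simp add: \<pi>_def nth_tl)
  qed
  hence "mean s k n (Suc m) (\<lambda>F. \<phi> (tl F)) = mean s k n (Suc m) (\<lambda>F. \<phi> (take m (permute_list \<pi> F)))"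
    by (intro mean_cong) simp
  also have "\<dots> = mean s k n (Suc m) (\<lambda>F. \<phi> (take m F))" by (rule mean_permute[OF \<pi>])
  finally show ?thesis using mean_tl[OF assms] by metis
qed

lemma mean_take:
  assumes "formulas s k n m \<noteq> {}" "i \<le> m"
  shows "mean s k n m (\<lambda>F. \<phi> (take i F)) = mean s k n i \<phi>"
  using assms
proof (induction m arbitrary: \<phi>)
  case (Suc m)
  show ?case
  proof (cases "i = Suc m")
    case True
    have "take i F = F" if "F \<in> formulas s k n i" for F
      using length_formulas[OF that] by simp
    hence "mean s k n i (\<lambda>F. \<phi> (take i F)) = mean s k n i \<phi>" by (intro mean_cong) simp
    thus ?thesis using True by simp
  next
    case False
    hence "mean s k n (Suc m) (\<lambda>F. \<phi> (take i (take m F))) = mean s k n m (\<lambda>F. \<phi> (take i F))"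
      by (intro mean_take_Suc Suc.prems)
    thus ?thesis using False Suc formulas_nonempty_Suc(1) by (simp add: min_def split: if_splits)
  qed
qed (auto simp: mean_def)

lemma sat_prob_eq_mean:
  assumes "formulas s k n m \<noteq> {}"
  shows "sat_prob s k n m = mean s k n m (\<lambda>F. of_bool (satisfiable F))"
  using assms finite_formulas
  by (simp add: sat_prob_def random_formula_def measure_pmf_of_set mean_def
      of_bool_def sum.If_cases Int_commute Collect_conj_eq)

lemma mean_cauchy_schwarz:
  assumes "formulas s k n m \<noteq> {}"
  shows "(mean s k n m (\<lambda>F. \<bar>\<phi> F\<bar>))\<^sup>2 \<le> mean s k n m (\<lambda>F. (\<phi> F)\<^sup>2)"
proof -
  let ?N = "real (card (formulas s k n m))"
  have N: "?N > 0" using assms finite_formulas by (simp add: card_gt_0_iff)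
  have "(\<Sum>F\<in>formulas s k n m. \<bar>\<phi> F\<bar>)\<^sup>2 \<le> ?N * (\<Sum>F\<in>formulas s k n m. (\<phi> F)\<^sup>2)"
    using sum_squared_le_sum_of_squares[of "\<lambda>F. \<bar>\<phi> F\<bar>" "formulas s k n m"]
    by (simp add: mult.commute)
  thus ?thesis unfolding mean_def using N by (simp add: divide_simps power2_eq_square mult_ac)
qed

section \<open>Avoiding a set of clauses\<close>

definition avoid_prob :: "sampling \<Rightarrow> nat \<Rightarrow> nat \<Rightarrow> nat \<Rightarrow> clause set \<Rightarrow> real" where
  "avoid_prob s k n m X = mean s k n m (\<lambda>F. of_bool (set F \<inter> X = {}))"

lemma avoid_prob_nonneg: "0 \<le> avoid_prob s k n m X"
  unfolding avoid_prob_def by (rule mean_nonneg) simp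

lemma avoid_prob_0: "avoid_prob s k n 0 X = 1"
  by (simp add: avoid_prob_def mean_def)

text \<open>Given that \<open>X\<close> has been avoided so far, all of it is still available, so
  the next draw hits it with probability \<open>card X / num_extensions s k n m\<close>.\<close>

lemma avoid_prob_Suc:
  assumes "formulas s k n (Suc m) \<noteq> {}" "X \<subseteq> k_clauses k n"
  shows "avoid_prob s k n (Suc m) X = avoid_prob s k n m X * (1 - card X / num_extensions s k n m)"
proof -
  let ?e = "real (num_extensions s k n m)"
  have e: "?e > 0" using formulas_nonempty_Suc[OF assms(1)] by simp
  have "(\<Sum>C\<in>extensions s k n F. of_bool (set (C # F) \<inter> X = {})) / ?e =
          (1 - card X / ?e) * of_bool (set F \<inter> X = {})" if F: "F \<in> formulas s k n m" for F
  proof (cases "set F \<inter> X = {}")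
    case True
    have "(\<Sum>C\<in>extensions s k n F. of_bool (set (C # F) \<inter> X = {})) =
            real (card (extensions s k n F - X))"
      using True by (simp add: sum.If_cases finite_extensions of_bool_def Diff_eq Collect_neg_eq)
    also have "\<dots> = ?e - card X"
      using card_extensions_avoiding[OF F assms(2) True] by (simp add: of_nat_diff)
    finally show ?thesis using True e by (simp add: field_simps)
  qed auto
  thus ?thesis unfolding avoid_prob_def mean_Suc
    by (subst mean_cong) (auto simp: mean_cmult)
qed

lemma avoid_prob_eq_prod:
  assumes "formulas s k n m \<noteq> {}" "X \<subseteq> k_clauses k n"
  shows "avoid_prob s k n m X = (\<Prod>r<m. 1 - card X / num_extensions s k n r)"
  using assms(1)
proof (induction m)
  case (Suc m)
  thus ?case using avoid_prob_Suc[OF Suc.prems assms(2)] formulas_nonempty_Suc(1) by simp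
qed (simp add: avoid_prob_0)

text \<open>While \<open>X\<close> is avoided, draws can only shrink the rest of the pool, so every
  draw hits \<open>X\<close> at least as likely as the first one does.\<close>

lemma avoid_prob_le_power:
  assumes "formulas s k n m \<noteq> {}" "X \<subseteq> k_clauses k n"
  shows "avoid_prob s k n m X \<le> (1 - card X / card (k_clauses k n)) ^ m"
  using assms(1)
proof (induction m)
  case (Suc m)
  let ?T = "real (card (k_clauses k n))" and ?e = "real (num_extensions s k n m)"
  have e: "?e > 0" "?e \<le> ?T"
    using formulas_nonempty_Suc[OF Suc.prems] num_extensions_le by auto
  have "card X \<le> ?T" using card_mono[OF finite_k_clauses assms(2)] by simp
  hence "0 \<le> 1 - card X / ?T" using e by simp
  moreover have "1 - card X / ?e \<le> 1 - card X / ?T"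
    using e by (simp add: frac_le)
  ultimately have "avoid_prob s k n m X * (1 - card X / ?e) \<le> (1 - card X / ?T) ^ m * (1 - card X / ?T)"
    using Suc formulas_nonempty_Suc(1) avoid_prob_nonneg
    by (meson mult_left_mono mult_right_mono order_trans)
  thus ?case using avoid_prob_Suc[OF Suc.prems assms(2)] by (simp add: mult.commute)
qed (simp add: avoid_prob_0)

text \<open>Compared draw by draw: by inclusion-exclusion
  \<open>1 - ?c \<le> (1 - ?a) * (1 - ?b)\<close> amounts to
  \<open>card (X \<inter> Y) / ?e \<le> ?a * ?b\<close>, which follows from the correlation
  hypothesis because \<open>?e \<le> ?T\<close>. The two size bounds keep the factors
  nonnegative.\<close>

lemma avoid_prob_Un_le:
  assumes "formulas s k n m \<noteq> {}" "X \<subseteq> k_clauses k n" "Y \<subseteq> k_clauses k n"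
    and "card (X \<inter> Y) * card (k_clauses k n) \<le> card X * card Y"
    and "card X \<le> num_extensions s k n m" "card Y \<le> num_extensions s k n m"
  shows "avoid_prob s k n m (X \<union> Y) \<le> avoid_prob s k n m X * avoid_prob s k n m Y"
  using assms(1,5,6)
proof (induction m)
  case (Suc m)
  let ?T = "real (card (k_clauses k n))" and ?e = "real (num_extensions s k n m)"
  let ?a = "card X / ?e" and ?b = "card Y / ?e" and ?c = "card (X \<union> Y) / ?e"
  let ?P = "avoid_prob s k n m"
  have e: "?e > 0" "?e \<le> ?T"
    using formulas_nonempty_Suc[OF Suc.prems(1)] num_extensions_le by auto
  have "num_extensions s k n (Suc m) \<le> num_extensions s k n m" by (cases s) auto
  hence le: "card X \<le> num_extensions s k n m" "card Y \<le> num_extensions s k n m"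
    using Suc.prems by auto
  have IH: "?P (X \<union> Y) \<le> ?P X * ?P Y"
    using Suc.IH le formulas_nonempty_Suc(1)[OF Suc.prems(1)] by blast
  have fin: "finite X" "finite Y" using assms(2,3) finite_k_clauses finite_subset by blast+
  have "card (X \<inter> Y) * ?e \<le> card (X \<inter> Y) * ?T" using e by (intro mult_left_mono) auto
  also have "\<dots> \<le> card X * card Y" using assms(4) by (metis of_nat_le_iff of_nat_mult)
  finally have "card (X \<inter> Y) / ?e \<le> ?a * ?b" using e by (simp add: field_simps)
  moreover have "?a + ?b = ?c + card (X \<inter> Y) / ?e"
    using card_Un_Int[OF fin] unfolding add_divide_distrib[symmetric] by (metis of_nat_add)
  moreover have "(1 - ?a) * (1 - ?b) = 1 - (?a + ?b) + ?a * ?b" by algebra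
  ultimately have c: "1 - ?c \<le> (1 - ?a) * (1 - ?b)" by linarith
  have nn: "0 \<le> (1 - ?a) * (1 - ?b)" using le e by simp
  have "?P (X \<union> Y) * (1 - ?c) \<le> ?P (X \<union> Y) * ((1 - ?a) * (1 - ?b))"
    using c avoid_prob_nonneg by (rule mult_left_mono)
  also have "\<dots> \<le> ?P X * ?P Y * ((1 - ?a) * (1 - ?b))"
    using IH nn by (rule mult_right_mono)
  finally show ?case
    using avoid_prob_Suc[OF Suc.prems(1)] assms(2,3) by (simp add: mult_ac)
qed (simp add: avoid_prob_0)

section \<open>Monotonicity and the first moment bound for satisfiability\<close>

lemma sat_prob_antimono:
  assumes "formulas s k n m \<noteq> {}" "i \<le> m"
  shows "sat_prob s k n m \<le> sat_prob s k n i"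
proof -
  have "sat_prob s k n m = mean s k n m (\<lambda>F. of_bool (satisfiable F))"
    by (rule sat_prob_eq_mean[OF assms(1)])
  also have "\<dots> \<le> mean s k n m (\<lambda>F. of_bool (satisfiable (take i F)))"
    by (intro mean_mono) (auto intro: satisfiable_mono[OF _ set_take_subset])
  \<comment> \<open>The first \<open>i\<close> draws of a longer random formula form a random
    formula with \<open>i\<close> clauses.\<close>
  also have "\<dots> = sat_prob s k n i"
    using mean_take[OF assms] formulas_nonempty_le[OF assms] by (simp add: sat_prob_eq_mean)
  finally show ?thesis .
qed

lemma sat_prob_0: "sat_prob s k n 0 = 1"
  by (subst sat_prob_eq_mean) (auto simp: mean_def satisfiable_def satisfies_def)

text \<open>Union bound over the \<open>2 ^ n\<close> assignments, each of which falsifies at least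
  a share \<open>1 / 2 ^ k\<close> of the clauses.\<close>

lemma sat_prob_le_first_moment:
  assumes "formulas s k n m \<noteq> {}" "k \<le> n"
  shows "sat_prob s k n m \<le> 2 ^ n * (1 - 1 / 2 ^ k) ^ m"
proof -
  \<comment> \<open>An assignment is encoded as the set \<open>P\<close> of its true variables;
    \<open>X P\<close> consists of the clauses it falsifies.\<close>
  define X where "X P = {C \<in> k_clauses k n. \<forall>l\<in>C. (var l \<in> P) \<noteq> is_pos l}" for P
  let ?T = "real (card (k_clauses k n))"
  have X: "X P \<subseteq> k_clauses k n" for P by (auto simp: X_def)
  have T: "?T > 0" using assms(2) by (simp add: card_k_clauses)
  have card_X: "n choose k \<le> card (X P)" for P
  proof -
    \<comment> \<open>On each set \<open>V\<close> of \<open>k\<close> variables, choosing the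
      literals false under \<open>P\<close> gives a falsified clause.\<close>
    let ?g = "\<lambda>V. (\<lambda>v. Literal v (v \<notin> P)) ` V"
    have "inj_on ?g {V. V \<subseteq> {..<n} \<and> card V = k}"
    proof (rule inj_on_inverseI[where g = "(`) var"])
      show "var ` ?g V = V" for V by force
    qed
    moreover have "?g ` {V. V \<subseteq> {..<n} \<and> card V = k} \<subseteq> X P"
      by (auto simp: X_def k_clauses_def inj_on_def card_image finite_subset)
    moreover have "finite (X P)" using X finite_k_clauses finite_subset by blast
    ultimately have "card {V. V \<subseteq> {..<n} \<and> card V = k} \<le> card (X P)"
      by (rule card_inj_on_le)
    thus ?thesis using n_subsets[of "{..<n}" k] by simp
  qed
  have "of_bool (satisfiable F) \<le> (\<Sum>P\<in>Pow {..<n}. of_bool (set F \<inter> X P = {}) :: real)"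
    if F: "F \<in> formulas s k n m" for F
  proof (cases "satisfiable F")
    case True
    then obtain A where A: "satisfies A F" unfolding satisfiable_def by blast
    define P where "P = {v. v < n \<and> A v}"
    have "C \<notin> X P" if C: "C \<in> set F" for C
    proof -
      obtain l where l: "l \<in> C" "A (var l) = is_pos l" using A C unfolding satisfies_def by blast
      have "var l < n" using set_formulas[OF F] C l(1) by (auto simp: k_clauses_def)
      thus ?thesis using l by (auto simp: X_def P_def)
    qed
    hence "set F \<inter> X P = {}" by blast
    moreover have "P \<in> Pow {..<n}" by (auto simp: P_def)
    ultimately have "(1::real) \<le> (\<Sum>P\<in>Pow {..<n}. of_bool (set F \<inter> X P = {}))"
      using member_le_sum[of P "Pow {..<n}" "\<lambda>P. of_bool (set F \<inter> X P = {}) :: real"] by simp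
    thus ?thesis using True by simp
  qed (simp add: sum_nonneg)
  hence "sat_prob s k n m \<le> (\<Sum>P\<in>Pow {..<n}. avoid_prob s k n m (X P))"
    unfolding sat_prob_eq_mean[OF assms(1)] avoid_prob_def mean_sum[symmetric] by (rule mean_mono)
  also have "\<dots> \<le> (\<Sum>P\<in>Pow {..<n}. (1 - 1 / 2 ^ k) ^ m)"
  proof (rule sum_mono)
    fix P
    have "?T / 2 ^ k \<le> card (X P)" using card_X[of P] by (simp add: card_k_clauses)
    hence "1 - card (X P) / ?T \<le> 1 - 1 / 2 ^ k" using T by (simp add: field_simps)
    moreover have "0 \<le> 1 - card (X P) / ?T"
      using card_mono[OF finite_k_clauses X] T by simp
    ultimately show "avoid_prob s k n m (X P) \<le> (1 - 1 / 2 ^ k) ^ m"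
      using avoid_prob_le_power[OF assms(1) X] power_mono order_trans by blast
  qed
  also have "\<dots> = 2 ^ n * (1 - 1 / 2 ^ k) ^ m" by (simp add: card_Pow)
  finally show ?thesis .
qed

section \<open>Missing literals and pure clauses\<close>

definition missing_literals :: "nat \<Rightarrow> formula \<Rightarrow> literal set" where
  "missing_literals n F = {l. var l < n \<and> l \<notin> \<Union>(set F)}"

definition has_pure_literal :: "formula \<Rightarrow> clause \<Rightarrow> bool" where
  "has_pure_literal F C \<longleftrightarrow> (\<exists>l\<in>C. negated l \<notin> \<Union>(set F))"

text \<open>The product form of \<open>avoid_prob\<close> for the clauses containing a fixed
  literal; by symmetry it is the same for all literals.\<close>

definition miss_prob :: "sampling \<Rightarrow> nat \<Rightarrow> nat \<Rightarrow> nat \<Rightarrow> real" where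
  "miss_prob s k n m =
     (\<Prod>r<m. 1 - k * card (k_clauses k n) / (2 * real n * num_extensions s k n r))"

lemma literals_below: "finite {l. var l < n}" "card {l. var l < n} = 2 * n"
proof -
  have *: "{l. var l < n} = (\<lambda>(v, b). Literal v b) ` ({..<n} \<times> UNIV)"
  proof (rule set_eqI)
    show "l \<in> {l. var l < n} \<longleftrightarrow> l \<in> (\<lambda>(v, b). Literal v b) ` ({..<n} \<times> UNIV)" for l
      by (cases l) auto
  qed
  show "finite {l. var l < n}" unfolding * by simp
  show "card {l. var l < n} = 2 * n"
    unfolding * by (subst card_image) (auto simp: inj_on_def card_cartesian_product)
qed

lemma finite_missing_literals: "finite (missing_literals n F)"
  unfolding missing_literals_def by (rule finite_subset[OF _ literals_below(1)]) auto

lemma card_with_literal_real: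
  assumes "var l < n" "1 \<le> k"
  shows "real (card {C \<in> k_clauses k n. l \<in> C}) = k * card (k_clauses k n) / (2 * real n)"
  using card_with_literal[OF assms, THEN arg_cong[where f = real]] assms(1)
  by (simp add: field_simps)

lemma avoid_prob_literal:
  assumes "formulas s k n m \<noteq> {}" "var l < n" "1 \<le> k"
  shows "avoid_prob s k n m {C \<in> k_clauses k n. l \<in> C} = miss_prob s k n m"
  by (subst avoid_prob_eq_prod[OF assms(1)])
    (auto simp: card_with_literal_real[OF assms(2,3)] miss_prob_def)

lemma card_missing_literals:
  assumes "F \<in> formulas s k n m"
  shows "real (card (missing_literals n F)) =
           (\<Sum>l | var l < n. of_bool (set F \<inter> {C \<in> k_clauses k n. l \<in> C} = {}))"
proof -
  have "missing_literals n F = {l. var l < n} \<inter> {l. set F \<inter> {C \<in> k_clauses k n. l \<in> C} = {}}"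
    using set_formulas[OF assms] by (auto simp: missing_literals_def)
  thus ?thesis by (simp add: literals_below of_bool_def sum.If_cases)
qed

lemma mean_card_missing_literals:
  assumes "formulas s k n m \<noteq> {}" "1 \<le> k"
  shows "mean s k n m (\<lambda>F. card (missing_literals n F)) = 2 * n * miss_prob s k n m"
proof -
  have "mean s k n m (\<lambda>F. card (missing_literals n F)) =
      (\<Sum>l | var l < n. avoid_prob s k n m {C \<in> k_clauses k n. l \<in> C})"
    unfolding avoid_prob_def mean_sum[symmetric] using card_missing_literals by (rule mean_cong)
  thus ?thesis using avoid_prob_literal[OF assms(1) _ assms(2)] by (simp add: literals_below)
qed

text \<open>The variance is at most the mean. The square is expanded over pairs of literals: off the
  diagonal negative correlation bounds a pair by \<open>?p\<^sup>2\<close>, on the diagonal it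
  contributes \<open>?p\<close>. The last hypothesis says that the clauses of one literal fit into
  the remaining pool, as \<open>avoid_prob_Un_le\<close> demands.\<close>

lemma mean_card_missing_literals_squared_le:
  assumes "formulas s k n m \<noteq> {}" "1 \<le> k" "k \<le> n"
    and "k * card (k_clauses k n) \<le> 2 * n * num_extensions s k n m"
  shows "mean s k n m (\<lambda>F. (real (card (missing_literals n F)))\<^sup>2) \<le>
           2 * real n * miss_prob s k n m + (2 * real n * miss_prob s k n m)\<^sup>2"
proof -
  let ?p = "miss_prob s k n m" and ?L = "{l. var l < n}"
  define X where "X l = {C \<in> k_clauses k n. l \<in> C}" for l
  have X: "X l \<subseteq> k_clauses k n" for l by (auto simp: X_def)
  have p: "avoid_prob s k n m (X l) = ?p" if "l \<in> ?L" for l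
    using avoid_prob_literal[OF assms(1) _ assms(2)] that by (simp add: X_def)
  have card_le: "card (X l) \<le> num_extensions s k n m" if "l \<in> ?L" for l
  proof -
    have "2 * n * card (X l) \<le> 2 * n * num_extensions s k n m"
      using card_with_literal[of l n k] that assms by (simp add: X_def)
    thus ?thesis using that by simp
  qed
  have pair: "avoid_prob s k n m (X l \<union> X l') \<le> ?p\<^sup>2 + of_bool (l = l') * ?p"
    if l: "l \<in> ?L" "l' \<in> ?L" for l l'
  proof (cases "l = l'")
    case False
    have "avoid_prob s k n m (X l \<union> X l') \<le> avoid_prob s k n m (X l) * avoid_prob s k n m (X l')"
    proof (rule avoid_prob_Un_le[OF assms(1) X X _ card_le card_le])
      have "X l \<inter> X l' = {C \<in> k_clauses k n. l \<in> C \<and> l' \<in> C}" by (auto simp: X_def)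
      thus "card (X l \<inter> X l') * card (k_clauses k n) \<le> card (X l) * card (X l')"
        using two_literals_negatively_correlated[of l n l' k] l False assms(2,3)
        by (simp add: X_def)
    qed (use l in auto)
    thus ?thesis using p l False by (simp add: power2_eq_square)
  qed (use p l in simp)
  have "mean s k n m (\<lambda>F. (real (card (missing_literals n F)))\<^sup>2) =
      (\<Sum>l\<in>?L. \<Sum>l'\<in>?L. avoid_prob s k n m (X l \<union> X l'))"
    unfolding avoid_prob_def mean_sum[symmetric]
  proof (rule mean_cong)
    fix F assume F: "F \<in> formulas s k n m"
    show "(real (card (missing_literals n F)))\<^sup>2 =
      (\<Sum>l\<in>?L. \<Sum>l'\<in>?L. of_bool (set F \<inter> (X l \<union> X l') = {}))"
      unfolding card_missing_literals[OF F] power2_eq_square sum_product X_def[symmetric]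
      by (intro sum.cong) (auto simp: Int_Un_distrib)
  qed
  also have "\<dots> \<le> (\<Sum>l\<in>?L. \<Sum>l'\<in>?L. ?p\<^sup>2 + of_bool (l = l') * ?p)"
    by (intro sum_mono pair)
  also have "\<dots> = (\<Sum>l\<in>?L. 2 * n * ?p\<^sup>2 + ?p)"
  proof (rule sum.cong[OF refl])
    fix l assume l: "l \<in> ?L"
    have "(\<Sum>l'\<in>?L. of_bool (l = l') * ?p) = (\<Sum>l'\<in>?L. if l' = l then ?p else 0)"
      by (rule sum.cong) auto
    also have "\<dots> = ?p" using l by (subst sum.delta) (auto simp: literals_below)
    finally show "(\<Sum>l'\<in>?L. ?p\<^sup>2 + of_bool (l = l') * ?p) = 2 * n * ?p\<^sup>2 + ?p"
      by (simp add: sum.distrib literals_below)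
  qed
  also have "\<dots> = 2 * real n * ?p + (2 * real n * ?p)\<^sup>2"
    by (simp add: literals_below power2_eq_square algebra_simps)
  finally show ?thesis .
qed

text \<open>Chebyshev's inequality: with mean \<open>\<mu>\<close> and variance at most
  \<open>\<mu>\<close>, a deviation of \<open>\<mu> / 4\<close> has probability at most
  \<open>16 / \<mu>\<close>.\<close>

lemma few_missing_literals_unlikely:
  assumes "formulas s k n m \<noteq> {}" "1 \<le> k" "k \<le> n" "miss_prob s k n m > 0"
    and "k * card (k_clauses k n) \<le> 2 * n * num_extensions s k n m"
  shows "mean s k n m (\<lambda>F. of_bool (card (missing_literals n F) < 3 / 2 * n * miss_prob s k n m))
           \<le> 8 / (n * miss_prob s k n m)"
proof -
  define \<mu> where "\<mu> = 2 * real n * miss_prob s k n m"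
  let ?L = "\<lambda>F. real (card (missing_literals n F))"
  have \<mu>: "\<mu> > 0" using assms by (simp add: \<mu>_def)
  have lower: "3 / 2 * n * miss_prob s k n m = 3 / 4 * \<mu>" by (simp add: \<mu>_def)
  have "mean s k n m (\<lambda>F. of_bool (?L F < 3 / 4 * \<mu>)) \<le>
      mean s k n m (\<lambda>F. 16 / \<mu>\<^sup>2 * (?L F - \<mu>)\<^sup>2)"
  proof (rule mean_mono)
    fix F
    show "of_bool (?L F < 3 / 4 * \<mu>) \<le> 16 / \<mu>\<^sup>2 * (?L F - \<mu>)\<^sup>2"
    proof (cases "?L F < 3 / 4 * \<mu>")
      case True
      hence "(\<mu> / 4)\<^sup>2 \<le> (\<mu> - ?L F)\<^sup>2" using \<mu> by (intro power_mono) auto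
      thus ?thesis using \<mu> True by (simp add: field_simps power2_commute)
    qed auto
  qed
  also have "\<dots> = 16 / \<mu>\<^sup>2 * mean s k n m (\<lambda>F. (?L F)\<^sup>2 - 2 * \<mu> * ?L F + \<mu>\<^sup>2)"
    unfolding mean_cmult by (simp add: power2_diff algebra_simps)
  also have "\<dots> = 16 / \<mu>\<^sup>2 * (mean s k n m (\<lambda>F. (?L F)\<^sup>2) - 2 * \<mu> * \<mu> + \<mu>\<^sup>2)"
    using mean_card_missing_literals[OF assms(1,2)]
    unfolding mean_add mean_diff mean_cmult mean_const[OF assms(1)] \<mu>_def by simp
  also have "\<dots> \<le> 16 / \<mu>\<^sup>2 * \<mu>"
  proof (rule mult_left_mono)
    have "mean s k n m (\<lambda>F. (?L F)\<^sup>2) \<le> \<mu> + \<mu>\<^sup>2"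
      unfolding \<mu>_def by (rule mean_card_missing_literals_squared_le[OF assms(1-3,5)])
    thus "mean s k n m (\<lambda>F. (?L F)\<^sup>2) - 2 * \<mu> * \<mu> + \<mu>\<^sup>2 \<le> \<mu>"
      by (simp add: power2_eq_square)
  qed simp
  also have "\<dots> = 8 / (n * miss_prob s k n m)"
    using \<mu> by (simp add: \<mu>_def power2_eq_square divide_simps)
  finally show ?thesis unfolding lower .
qed

section \<open>Counting pure clauses\<close>

lemma has_pure_literal_iff:
  assumes "C \<in> k_clauses k n"
  shows "has_pure_literal F C \<longleftrightarrow> (\<exists>l\<in>missing_literals n F. negated l \<in> C)"
proof
  assume "has_pure_literal F C"
  then obtain l where l: "l \<in> C" "negated l \<notin> \<Union>(set F)" unfolding has_pure_literal_def by blast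
  have "var l < n" using assms l(1) by (auto simp: k_clauses_def)
  thus "\<exists>l\<in>missing_literals n F. negated l \<in> C"
    using l by (intro bexI[of _ "negated l"]) (auto simp: missing_literals_def)
next
  assume "\<exists>l\<in>missing_literals n F. negated l \<in> C"
  thus "has_pure_literal F C"
    unfolding has_pure_literal_def missing_literals_def by (metis (mono_tags, lifting) mem_Collect_eq negated_negated)
qed

text \<open>Distinct variables keep a clause from containing the negation of one of its own
  literals, so its purity is decided by the other clauses.\<close>

lemma has_pure_literal_Cons:
  assumes "C \<in> k_clauses k n"
  shows "has_pure_literal (C # F) C \<longleftrightarrow> has_pure_literal F C"
proof -
  have "negated l \<notin> C" if "l \<in> C" for l
    using assms that by (auto simp: k_clauses_def dest!: inj_onD[where x = "negated l" and y = l])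
  thus ?thesis by (auto simp: has_pure_literal_def)
qed

text \<open>Double counting of pairs of a missing literal and a clause containing its negation: each
  literal is in \<open>k / (2 * n)\<close> of all clauses as a partner, and each pure clause is
  counted between once and \<open>k\<close> times.\<close>

lemma card_pure_clauses_bounds:
  assumes "1 \<le> k"
  shows "card (missing_literals n F) * card (k_clauses k n)
           \<le> 2 * n * card {C \<in> k_clauses k n. has_pure_literal F C}"
    and "2 * n * card {C \<in> k_clauses k n. has_pure_literal F C}
           \<le> k * card (missing_literals n F) * card (k_clauses k n)"
proof -
  let ?L = "missing_literals n F" and ?K = "k_clauses k n"
  let ?B = "{C \<in> k_clauses k n. has_pure_literal F C}"
  define X where "X l = {C \<in> ?K. negated l \<in> C}" for l
  have X: "2 * n * card (X l) = k * card ?K" if "l \<in> ?L" for l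
    using card_with_literal[of "negated l" n k] assms that by (simp add: X_def missing_literals_def)
  have finX: "finite (X l)" for l using finite_k_clauses by (simp add: X_def)
  have B: "?B = (\<Union>l\<in>?L. X l)" using has_pure_literal_iff by (auto simp: X_def)
  have sumX: "2 * n * (\<Sum>l\<in>?L. card (X l)) = k * card ?L * card ?K"
    using X by (simp add: sum_distrib_left)
  have "card ?B \<le> (\<Sum>l\<in>?L. card (X l))"
    unfolding B by (rule card_UN_le[OF finite_missing_literals])
  hence "2 * n * card ?B \<le> 2 * n * (\<Sum>l\<in>?L. card (X l))" by simp
  thus "2 * n * card ?B \<le> k * card ?L * card ?K" unfolding sumX .
  have "(\<Sum>l\<in>?L. card (X l)) = (\<Sum>l\<in>?L. \<Sum>C\<in>?B. of_bool (negated l \<in> C))"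
  proof (rule sum.cong[OF refl])
    fix l assume "l \<in> ?L"
    hence "X l = ?B \<inter> {C. negated l \<in> C}" unfolding B by (auto simp: X_def)
    thus "card (X l) = (\<Sum>C\<in>?B. of_bool (negated l \<in> C))"
      using finite_k_clauses[of k n] by (simp add: of_bool_def sum.If_cases)
  qed
  also have "\<dots> = (\<Sum>C\<in>?B. \<Sum>l\<in>?L. of_bool (negated l \<in> C))" by (rule sum.swap)
  also have "\<dots> \<le> (\<Sum>C\<in>?B. k)"
  proof (rule sum_mono)
    fix C assume "C \<in> ?B"
    hence C: "finite C" "card C = k" by (auto simp: k_clauses_def)
    have "(\<Sum>l\<in>?L. of_bool (negated l \<in> C)) = card (?L \<inter> {l. negated l \<in> C})"
      by (simp add: finite_missing_literals of_bool_def sum.If_cases)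
    also have "\<dots> \<le> card C"
      by (rule card_inj_on_le[OF inj_negated _ C(1)]) auto
    finally show "(\<Sum>l\<in>?L. of_bool (negated l \<in> C)) \<le> k" using C by simp
  qed
  finally have "2 * n * (\<Sum>l\<in>?L. card (X l)) \<le> 2 * n * (k * card ?B)" by (simp add: mult.commute)
  hence "k * (card ?L * card ?K) \<le> k * (2 * n * card ?B)"
    unfolding sumX by (simp add: mult_ac)
  thus "card ?L * card ?K \<le> 2 * n * card ?B" using assms by simp
qed

text \<open>All literals of an impure clause are negations of the at most \<open>k * m\<close>
  literals of \<open>F\<close>. Since \<open>k \<ge> 2\<close>, it contains two of them with
  different variables, and there are at most \<open>(k * m)\<^sup>2\<close> such pairs.\<close>

lemma card_impure_clauses_le:
  assumes "F \<in> formulas s k n m" "2 \<le> k"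
  shows "4 * n * (n - 1) * card {C \<in> k_clauses k n. \<not> has_pure_literal F C}
           \<le> (k * m)\<^sup>2 * (k * (k - 1) * card (k_clauses k n))"
proof -
  let ?K = "k_clauses k n"
  define U where "U = negated ` \<Union>(set F)"
  have "card (\<Union>(set F)) \<le> k * m"
  proof -
    have "card (\<Union>(set F)) \<le> (\<Sum>C\<in>set F. card C)" using card_UN_le[of "set F" id] by simp
    also have "\<dots> \<le> (\<Sum>C\<in>set F. k)"
      using set_formulas[OF assms(1)] by (intro sum_mono) (auto simp: k_clauses_def)
    also have "\<dots> \<le> k * m"
      using card_length[of F] length_formulas[OF assms(1)] by (simp add: mult.commute)
    finally show ?thesis .
  qed
  moreover have "finite (\<Union>(set F))"
    using set_formulas[OF assms(1)] by (auto simp: k_clauses_def)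
  ultimately have U: "finite U" "card U \<le> k * m"
    unfolding U_def using card_image_le order_trans by blast+
  have Un: "var l < n" if l: "l \<in> U" for l
  proof -
    obtain C l' where C: "C \<in> set F" "l' \<in> C" "l = negated l'" using l by (auto simp: U_def)
    hence "C \<in> k_clauses k n" using set_formulas[OF assms(1)] by blast
    thus ?thesis using C by (auto simp: k_clauses_def)
  qed
  define I where "I = {(l, l') \<in> U \<times> U. var l \<noteq> var l'}"
  have I: "finite I" "card I \<le> (k * m)\<^sup>2"
  proof -
    have sub: "I \<subseteq> U \<times> U" by (auto simp: I_def)
    show "finite I" by (rule finite_subset[OF sub]) (use U in simp)
    have "card I \<le> card (U \<times> U)" by (rule card_mono[OF _ sub]) (use U in simp)
    also have "\<dots> \<le> (k * m)\<^sup>2"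
      using mult_le_mono[OF U(2) U(2)] by (simp add: card_cartesian_product power2_eq_square)
    finally show "card I \<le> (k * m)\<^sup>2" .
  qed
  define Y where "Y i = {C \<in> ?K. fst i \<in> C \<and> snd i \<in> C}" for i
  have "{C \<in> ?K. \<not> has_pure_literal F C} \<subseteq> (\<Union>i\<in>I. Y i)"
  proof
    fix C assume C: "C \<in> {C \<in> ?K. \<not> has_pure_literal F C}"
    have CU: "C \<subseteq> U"
    proof
      fix l assume "l \<in> C"
      hence "negated l \<in> \<Union>(set F)" using C by (auto simp: has_pure_literal_def)
      thus "l \<in> U" unfolding U_def by (metis image_eqI negated_negated)
    qed
    have C': "card C = k" "inj_on var C" using C by (auto simp: k_clauses_def)
    obtain l l' where l: "l \<in> C" "l' \<in> C" "l \<noteq> l'"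
      using C'(1) assms(2) by (metis One_nat_def card_le_Suc0_iff_eq card.infinite not_less_eq_eq numeral_2_eq_2 zero_le)
    hence "var l \<noteq> var l'" using C'(2) by (meson inj_onD)
    hence "(l, l') \<in> I" using l CU by (auto simp: I_def)
    thus "C \<in> (\<Union>i\<in>I. Y i)" using l C by (intro UN_I[of "(l, l')"]) (auto simp: Y_def)
  qed
  hence "card {C \<in> ?K. \<not> has_pure_literal F C} \<le> card (\<Union>i\<in>I. Y i)"
    using I(1) finite_k_clauses by (intro card_mono) (auto simp: Y_def)
  also have "\<dots> \<le> (\<Sum>i\<in>I. card (Y i))" by (rule card_UN_le[OF I(1)])
  finally have "4 * n * (n - 1) * card {C \<in> ?K. \<not> has_pure_literal F C} \<le>
      (\<Sum>i\<in>I. 4 * n * (n - 1) * card (Y i))"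
    unfolding sum_distrib_left[symmetric] by (rule mult_le_mono2)
  also have "\<dots> = (\<Sum>i\<in>I. k * (k - 1) * card ?K)"
  proof (rule sum.cong[OF refl])
    fix i assume "i \<in> I"
    hence "var (fst i) < n" "var (snd i) < n" "var (fst i) \<noteq> var (snd i)"
      using Un by (auto simp: I_def)
    thus "4 * n * (n - 1) * card (Y i) = k * (k - 1) * card ?K"
      unfolding Y_def by (rule card_with_two_literals[OF _ _ _ assms(2)])
  qed
  also have "\<dots> = card I * (k * (k - 1) * card ?K)" by simp
  also have "\<dots> \<le> (k * m)\<^sup>2 * (k * (k - 1) * card ?K)" using I(2) by (rule mult_le_mono1)
  finally show ?thesis .
qed

section \<open>The drop of satisfiability caused by one clause\<close>

definition pure_at :: "nat \<Rightarrow> formula \<Rightarrow> real" where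
  "pure_at r F = of_bool (has_pure_literal F (F ! r))"

lemma pure_at_permute:
  assumes "\<pi> permutes {..<length F}" "r < length F"
  shows "pure_at r (permute_list \<pi> F) = pure_at (\<pi> r) F"
  using assms by (simp add: pure_at_def has_pure_literal_def permute_list_nth)

lemma transpose_permutes:
  "a < M \<Longrightarrow> b < M \<Longrightarrow> Transposition.transpose a b permutes {..<M}"
  by (rule permutes_swap_id) auto

lemma set_take_permute_list:
  assumes "\<pi> permutes {..<length F}" "i \<le> length F"
  shows "set (take i (permute_list \<pi> F)) = (!) F ` \<pi> ` {..<i}"
proof -
  have "set (take i (permute_list \<pi> F)) = (!) (permute_list \<pi> F) ` {..<i}"
    using nth_image[of i "permute_list \<pi> F"] assms(2) by (simp add: lessThan_atLeast0)
  also have "\<dots> = (\<lambda>j. F ! \<pi> j) ` {..<i}"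
    using permute_list_nth[of \<pi> F] assms by (intro image_cong) auto
  finally show ?thesis by (simp add: image_image)
qed

text \<open>Shape of the second moment of a weighted sum of exchangeable variables: \<open>c\<close>
  is the common mean of a product of two, \<open>c + d\<close> the mean square.\<close>

lemma double_sum_diagonal:
  fixes w :: "nat \<Rightarrow> real"
  assumes "finite I"
  shows "(\<Sum>r\<in>I. \<Sum>q\<in>I. w r * w q * (c + of_bool (r = q) * d)) =
           c * (\<Sum>r\<in>I. w r)\<^sup>2 + d * (\<Sum>r\<in>I. (w r)\<^sup>2)"
proof -
  have "(\<Sum>q\<in>I. w r * w q * (c + of_bool (r = q) * d)) = c * (w r * (\<Sum>q\<in>I. w q)) + d * (w r)\<^sup>2"
    if "r \<in> I" for r
  proof -
    have "(\<Sum>q\<in>I. w r * w q * (c + of_bool (r = q) * d)) =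
        (\<Sum>q\<in>I. c * (w r * w q) + (if q = r then d * (w r)\<^sup>2 else 0))"
      by (rule sum.cong) (auto simp: algebra_simps power2_eq_square)
    thus ?thesis using that assms by (simp add: sum.distrib sum_distrib_left)
  qed
  thus ?thesis
    by (simp add: sum.distrib sum_distrib_left[symmetric] sum_distrib_right[symmetric] power2_eq_square)
qed

text \<open>The drop is measured between \<open>m - 1\<close> and \<open>m\<close> clauses. The
  \<open>x\<close> further draws serve only for comparison, and \<open>x\<close> is left free to be
  balanced against \<open>m\<close>.\<close>

locale sat_window =
  fixes s :: sampling and k n m x :: nat
  assumes k: "2 \<le> k" "k \<le> n" and m: "1 \<le> m" and x: "1 \<le> x"
    and nonempty: "formulas s k n (m + x) \<noteq> {}"
begin

abbreviation "M \<equiv> m + x"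
abbreviation "E \<equiv> mean s k n M"
abbreviation "T \<equiv> real (card (k_clauses k n))"

definition sat_first :: "formula \<Rightarrow> real" where
  "sat_first F = of_bool (satisfiable (take m F))"

definition "p_pure = E (pure_at 0)"
definition "p_pure2 = E (\<lambda>F. pure_at 0 F * pure_at 1 F)"

section \<open>Exchangeability of the purity indicators\<close>

lemma mean_pure_at:
  assumes "r < M"
  shows "E (pure_at r) = p_pure"
proof -
  let ?\<pi> = "Transposition.transpose 0 r"
  have \<pi>: "?\<pi> permutes {..<M}" using assms by (intro transpose_permutes) auto
  have "E (\<lambda>F. pure_at 0 (permute_list ?\<pi> F)) = E (pure_at r)"
  proof (rule mean_cong)
    fix F assume "F \<in> formulas s k n M"
    thus "pure_at 0 (permute_list ?\<pi> F) = pure_at r F"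
      using pure_at_permute[of ?\<pi> F 0] \<pi> length_formulas m by force
  qed
  thus ?thesis using mean_permute[OF \<pi>, of s k n "pure_at 0"] by (simp add: p_pure_def)
qed

lemma mean_pure_at_pair:
  assumes "r < M" "q < M" "r \<noteq> q"
  shows "E (\<lambda>F. pure_at r F * pure_at q F) = p_pure2"
proof -
  \<comment> \<open>\<open>?q\<close> is the preimage of \<open>q\<close> under the first
    transposition, so that \<open>?\<pi>\<close> sends \<open>0\<close> to \<open>r\<close> and
    \<open>1\<close> to \<open>q\<close>.\<close>
  let ?q = "Transposition.transpose 0 r q"
  let ?\<pi> = "Transposition.transpose 0 r \<circ> Transposition.transpose 1 ?q"
  have "?q < M" using assms m by (auto simp: Transposition.transpose_def)
  hence \<pi>: "?\<pi> permutes {..<M}"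
    using assms m x by (intro permutes_compose transpose_permutes) auto
  have "?q \<noteq> 0" using assms(3) by (auto simp: Transposition.transpose_def)
  hence \<pi>01: "?\<pi> 0 = r" "?\<pi> 1 = q" by (simp_all add: transpose_apply_other)
  have "pure_at i (permute_list ?\<pi> F) = pure_at (?\<pi> i) F"
    if "F \<in> formulas s k n M" "i < M" for F i
    using pure_at_permute[of ?\<pi> F i] \<pi> length_formulas[OF that(1)] that(2) by simp
  hence "E (\<lambda>F. pure_at 0 (permute_list ?\<pi> F) * pure_at 1 (permute_list ?\<pi> F)) =
      E (\<lambda>F. pure_at (?\<pi> 0) F * pure_at (?\<pi> 1) F)"
    using m x by (intro mean_cong) simp
  thus ?thesis
    using mean_permute[OF \<pi>, of s k n "\<lambda>F. pure_at 0 F * pure_at 1 F"]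
    unfolding \<pi>01 p_pure2_def by simp
qed

text \<open>The difference is the probability that clause \<open>0\<close> is pure and clause
  \<open>1\<close> is not, hence at most that of either event. The first bound serves when pure
  clauses are rare, the second when impure ones are.\<close>

lemma p_pure_variance_le: "p_pure - p_pure2 \<le> p_pure" "p_pure - p_pure2 \<le> 1 - p_pure"
proof -
  show "p_pure - p_pure2 \<le> p_pure"
    unfolding p_pure2_def using mean_nonneg[of s k n M "\<lambda>F. pure_at 0 F * pure_at 1 F"]
    by (simp add: pure_at_def)
  have "p_pure - p_pure2 = E (\<lambda>F. pure_at 0 F - pure_at 0 F * pure_at 1 F)"
    unfolding mean_diff p_pure_def p_pure2_def ..
  also have "\<dots> \<le> E (\<lambda>F. 1 - pure_at 1 F)" by (rule mean_mono) (auto simp: pure_at_def)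
  also have "\<dots> = 1 - p_pure"
    unfolding mean_diff using mean_pure_at[of 1] mean_const[OF nonempty] m x by simp
  finally show "p_pure - p_pure2 \<le> 1 - p_pure" .
qed

section \<open>Mean and variance of the imbalance\<close>

definition "weight r = (if r < m then real x else - real m)"
text \<open>Equals \<open>m * x\<close> times the difference between the fractions of pure clauses
  among the first \<open>m\<close> and the last \<open>x\<close>.\<close>

definition "imbalance F = (\<Sum>r<M. weight r * pure_at r F)"

lemma sum_weight_eq:
  fixes f :: "nat \<Rightarrow> real"
  shows "(\<Sum>r<M. weight r * f r) = x * (\<Sum>r<m. f r) - m * (\<Sum>r=m..<M. f r)"
proof -
  have "(\<Sum>r<M. weight r * f r) = (\<Sum>r<m. weight r * f r) + (\<Sum>r=m..<M. weight r * f r)"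
    using sum.atLeastLessThan_concat[of 0 m M "\<lambda>r. weight r * f r"] by (simp add: lessThan_atLeast0)
  also have "(\<Sum>r<m. weight r * f r) = x * (\<Sum>r<m. f r)"
    unfolding sum_distrib_left by (rule sum.cong) (auto simp: weight_def)
  also have "(\<Sum>r=m..<M. weight r * f r) = - (m * (\<Sum>r=m..<M. f r))"
    unfolding sum_distrib_left sum_negf[symmetric] by (rule sum.cong) (auto simp: weight_def)
  finally show ?thesis by simp
qed

lemma sum_weight: "(\<Sum>r<M. weight r) = 0"
  using sum_weight_eq[of "\<lambda>_. 1"] by simp

lemma sum_weight_squared: "(\<Sum>r<M. (weight r)\<^sup>2) = m * x * (m + x)"
proof -
  have "(\<Sum>r<M. (weight r)\<^sup>2) = x * (\<Sum>r<m. weight r) - m * (\<Sum>r=m..<M. weight r)"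
    unfolding sum_weight_eq[symmetric] by (simp add: power2_eq_square)
  also have "(\<Sum>r<m. weight r) = m * x" by (simp add: weight_def)
  also have "(\<Sum>r=m..<M. weight r) = - (x * m)" by (simp add: weight_def)
  finally show ?thesis by (simp add: algebra_simps)
qed

lemma mean_imbalance: "E imbalance = 0"
proof -
  have "E imbalance = (\<Sum>r<M. weight r * p_pure)"
    unfolding imbalance_def mean_sum mean_cmult using mean_pure_at by simp
  also have "\<dots> = 0" using sum_weight by (simp add: sum_distrib_right[symmetric])
  finally show ?thesis .
qed

text \<open>Because the weights sum to zero, the common pair mean \<open>p_pure2\<close> cancels and
  only the diagonal term remains.\<close>

lemma mean_imbalance_squared: "E (\<lambda>F. (imbalance F)\<^sup>2) = m * x * (m + x) * (p_pure - p_pure2)"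
proof -
  have *: "E (\<lambda>F. pure_at r F * pure_at q F) = p_pure2 + of_bool (r = q) * (p_pure - p_pure2)"
    if "r < M" "q < M" for r q
  proof (cases "r = q")
    case True
    have "E (\<lambda>F. pure_at r F * pure_at r F) = E (pure_at r)"
      by (rule mean_cong) (simp add: pure_at_def)
    thus ?thesis using True that mean_pure_at by simp
  qed (use mean_pure_at_pair[OF that] in simp)
  have "(imbalance F)\<^sup>2 = (\<Sum>r<M. \<Sum>q<M. weight r * weight q * (pure_at r F * pure_at q F))" for F
    unfolding imbalance_def power2_eq_square sum_product by (simp add: mult_ac)
  hence "E (\<lambda>F. (imbalance F)\<^sup>2) =
      (\<Sum>r<M. \<Sum>q<M. weight r * weight q * E (\<lambda>F. pure_at r F * pure_at q F))"
    by (simp add: mean_sum mean_cmult)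
  also have "\<dots> = (\<Sum>r<M. \<Sum>q<M. weight r * weight q *
      (p_pure2 + of_bool (r = q) * (p_pure - p_pure2)))"
    by (intro sum.cong refl) (simp add: *)
  also have "\<dots> = m * x * (m + x) * (p_pure - p_pure2)"
    by (subst double_sum_diagonal) (simp_all add: sum_weight sum_weight_squared)
  finally show ?thesis .
qed

text \<open>A transposition within one of the two blocks preserves the set of the first
  \<open>m\<close> clauses and therefore \<open>sat_first\<close>.\<close>

lemma mean_sat_first_pure_at:
  assumes "r < M"
  shows "E (\<lambda>F. sat_first F * pure_at r F) =
           E (\<lambda>F. sat_first F * pure_at (if r < m then 0 else m) F)"
proof -
  define b where "b = (if r < m then 0 else m)"
  let ?\<pi> = "Transposition.transpose b r"
  have bM: "b < M" using m x by (simp add: b_def)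
  have \<pi>: "?\<pi> permutes {..<M}" using bM assms by (rule transpose_permutes)
  have im: "?\<pi> ` {..<m} = {..<m}"
    by (rule transpose_image_eq) (auto simp: b_def)
  have "E (\<lambda>F. sat_first (permute_list ?\<pi> F) * pure_at b (permute_list ?\<pi> F)) =
      E (\<lambda>F. sat_first F * pure_at r F)"
  proof (rule mean_cong)
    fix F assume F: "F \<in> formulas s k n M"
    note len = length_formulas[OF F]
    have "set (take m (permute_list ?\<pi> F)) = (!) F ` {..<m}"
      using set_take_permute_list[of ?\<pi> F m] \<pi> len im by simp
    also have "\<dots> = set (take m F)"
      using nth_image[of m F] len by (simp add: lessThan_atLeast0)
    finally have "satisfiable (take m (permute_list ?\<pi> F)) = satisfiable (take m F)"
      by (rule satisfiable_cong)
    hence "sat_first (permute_list ?\<pi> F) = sat_first F" by (simp add: sat_first_def)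
    moreover have "pure_at b (permute_list ?\<pi> F) = pure_at r F"
      using pure_at_permute[of ?\<pi> F b] \<pi> len bM by simp
    ultimately show "sat_first (permute_list ?\<pi> F) * pure_at b (permute_list ?\<pi> F) =
        sat_first F * pure_at r F" by simp
  qed
  thus ?thesis
    using mean_permute[OF \<pi>, of s k n "\<lambda>F. sat_first F * pure_at b F"] by (simp add: b_def)
qed

definition "correlation = E (\<lambda>F. sat_first F * (pure_at 0 F - pure_at m F))"

text \<open>
  By exchangeability within the first \<open>m\<close> and within the last \<open>x\<close> clauses, \<^term>\<open>m * x * correlation\<close>
  is the covariance of \<^const>\<open>sat_first\<close> and \<^const>\<open>imbalance\<close>.
\<close>

lemma correlation_le:
  assumes "v \<ge> p_pure - p_pure2"
  shows "correlation \<le> sqrt ((1 / m + 1 / x) * v) / 2"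
proof -
  have mx: "real m * x > 0" using m x by simp
  let ?A = "\<lambda>i. E (\<lambda>F. sat_first F * pure_at i F)"
  have "sat_first F * imbalance F = (\<Sum>r<M. weight r * (sat_first F * pure_at r F))" for F
    unfolding imbalance_def sum_distrib_left by (rule sum.cong) simp_all
  hence "E (\<lambda>F. sat_first F * imbalance F) = (\<Sum>r<M. weight r * ?A r)"
    by (simp only: mean_sum mean_cmult)
  also have "\<dots> = (\<Sum>r<M. weight r * ?A (if r < m then 0 else m))"
    by (intro sum.cong refl arg_cong2[where f = "(*)"] mean_sat_first_pure_at) simp
  also have "\<dots> = x * (m * ?A 0) - m * (x * ?A m)"
  proof -
    have "(\<Sum>r<m. ?A (if r < m then 0 else m)) = (\<Sum>r<m. ?A 0)" by (rule sum.cong) auto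
    moreover have "(\<Sum>r=m..<M. ?A (if r < m then 0 else m)) = (\<Sum>r=m..<M. ?A m)"
      by (rule sum.cong) auto
    ultimately show ?thesis unfolding sum_weight_eq by simp
  qed
  also have "\<dots> = real m * real x * correlation"
  proof -
    have "correlation = ?A 0 - ?A m"
      unfolding correlation_def right_diff_distrib mean_diff ..
    thus ?thesis by (simp add: right_diff_distrib)
  qed
  finally have "real m * real x * correlation = E (\<lambda>F. sat_first F * imbalance F)" by (rule sym)
  \<comment> \<open>Centering the indicator at \<open>1 / 2\<close>, allowed since the imbalance has
    mean zero, gives it constant absolute value \<open>1 / 2\<close> and so gains a factor
    \<open>2\<close>.\<close>
  also have "\<dots> = E (\<lambda>F. sat_first F * imbalance F - 1 / 2 * imbalance F)"
    unfolding mean_diff mean_cmult mean_imbalance by simp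
  also have "\<dots> \<le> E (\<lambda>F. 1 / 2 * \<bar>imbalance F\<bar>)"
    by (rule mean_mono) (auto simp: sat_first_def)
  also have "\<dots> = 1 / 2 * E (\<lambda>F. \<bar>imbalance F\<bar>)" by (rule mean_cmult)
  finally have upper: "real m * real x * correlation \<le> 1 / 2 * E (\<lambda>F. \<bar>imbalance F\<bar>)" .
  have variance: "E (\<lambda>F. (imbalance F)\<^sup>2) \<le> (real m * real x)\<^sup>2 * ((1 / m + 1 / x) * v)"
  proof -
    have "E (\<lambda>F. (imbalance F)\<^sup>2) \<le> real m * real x * (real m + real x) * v"
      unfolding mean_imbalance_squared using assms by (simp add: mult_left_mono)
    also have "real m * real x * (real m + real x) * v =
        (real m * real x)\<^sup>2 * ((real m + real x) / (real m * real x) * v)"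
      using mx by (simp add: power2_eq_square)
    also have "(real m + real x) / (real m * real x) = 1 / m + 1 / x"
      using m x by (simp add: add_divide_distrib)
    finally show ?thesis .
  qed
  have "E (\<lambda>F. \<bar>imbalance F\<bar>) \<le> sqrt (E (\<lambda>F. (imbalance F)\<^sup>2))"
    by (rule real_le_rsqrt[OF mean_cauchy_schwarz[OF nonempty]])
  also have "\<dots> \<le> sqrt ((real m * real x)\<^sup>2 * ((1 / m + 1 / x) * v))"
    using variance by (rule real_sqrt_le_mono)
  also have "\<dots> = real m * real x * sqrt ((1 / m + 1 / x) * v)"
    using mx by (simp add: real_sqrt_mult)
  finally have "real m * real x * correlation \<le> real m * real x * (sqrt ((1 / m + 1 / x) * v) / 2)"
    using upper by simp
  thus ?thesis using mx by (simp only: mult_le_cancel_left_pos)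
qed

section \<open>Evaluating the correlation by deleting a pure clause\<close>

abbreviation "N \<equiv> m + x - 1"
abbreviation "e \<equiv> real (num_extensions s k n N)"

lemma Suc_N: "Suc N = M"
  using m by simp

lemma nonempty_N: "formulas s k n N \<noteq> {}"
  and e_pos: "e > 0"
  using formulas_nonempty_Suc[of s k n N] nonempty unfolding Suc_N by simp_all

definition "sat_drop G = of_bool (satisfiable (take (m - 1) G)) - (of_bool (satisfiable (take m G)) :: real)"

definition "pure_extensions G = {C \<in> extensions s k n G. has_pure_literal G C}"

lemma pure_at_0_Cons:
  assumes "C \<in> extensions s k n G"
  shows "pure_at 0 (C # G) = of_bool (has_pure_literal G C)"
  using has_pure_literal_Cons[OF subsetD[OF extensions_subset assms]] by (simp add: pure_at_def)

text \<open>Conditioning on the tail: the head is a uniform extension of it, and its purity is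
  judged against the tail alone.\<close>

lemma mean_times_pure_at_0:
  "E (\<lambda>F. \<phi> (tl F) * pure_at 0 F) = mean s k n N (\<lambda>G. \<phi> G * (card (pure_extensions G) / e))"
  unfolding mean_Suc[of s k n N, unfolded Suc_N]
proof (rule mean_cong)
  fix G
  have "(\<Sum>C\<in>extensions s k n G. \<phi> (tl (C # G)) * pure_at 0 (C # G)) =
      (\<Sum>C\<in>extensions s k n G. \<phi> G * of_bool (has_pure_literal G C))"
    by (rule sum.cong) (simp_all add: pure_at_0_Cons)
  also have "\<dots> = \<phi> G * card (pure_extensions G)"
    by (simp add: pure_extensions_def sum_distrib_left[symmetric] sum.If_cases of_bool_def
        finite_extensions Int_def)
  finally show "(\<Sum>C\<in>extensions s k n G. \<phi> (tl (C # G)) * pure_at 0 (C # G)) / e =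
      \<phi> G * (card (pure_extensions G) / e)" by simp
qed

text \<open>
  Exchanging the clauses at positions \<open>0\<close> and \<open>m\<close> turns both terms of the correlation into
  statements about a pure clause at position \<open>0\<close>, which may be deleted without affecting
  satisfiability.
\<close>

lemma correlation_eq:
  "correlation = mean s k n N (\<lambda>G. sat_drop G * (card (pure_extensions G) / e))"
proof -
  let ?\<pi> = "Transposition.transpose 0 m"
  have \<pi>: "?\<pi> permutes {..<M}" using m x by (intro transpose_permutes) auto
  \<comment> \<open>A pure head may be dropped from the first \<open>m\<close> clauses, which leaves
    \<open>m - 1\<close> clauses of the tail; if it is not pure, both sides vanish.\<close>
  have 1: "sat_first F * pure_at 0 F = of_bool (satisfiable (take (m - 1) (tl F))) * pure_at 0 F"
    if F: "F \<in> formulas s k n M" for F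
  proof (cases "has_pure_literal F (F ! 0)")
    case True
    obtain C G where CG: "F = C # G" using length_formulas[OF F] m by (cases F) auto
    obtain l where l: "l \<in> C" "negated l \<notin> \<Union>(set F)"
      using True CG by (auto simp: has_pure_literal_def)
    have "negated l \<notin> \<Union>(set (take (m - 1) G))"
      using l(2) CG set_take_subset[of "m - 1" G] by auto
    hence "satisfiable (C # take (m - 1) G) = satisfiable (take (m - 1) G)"
      using satisfiable_pure_clause l(1) by blast
    thus ?thesis using CG m by (simp add: sat_first_def take_Cons')
  qed (simp add: pure_at_def)
  have 2: "sat_first (permute_list ?\<pi> F) * pure_at m (permute_list ?\<pi> F) =
      of_bool (satisfiable (take m (tl F))) * pure_at 0 F" if F: "F \<in> formulas s k n M" for F
  proof -
    note len = length_formulas[OF F]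
    \<comment> \<open>After the exchange, the first block holds positions \<open>1\<close> to
      \<open>m\<close>, which are the first \<open>m\<close> positions of the tail.\<close>
    have "?\<pi> ` {..<m} = Suc ` {..<m}"
    proof -
      have "?\<pi> i \<in> Suc ` {..<m}" if "i < m" for i
        using that m by (cases i) (auto simp: Transposition.transpose_def image_iff intro: bexI[of _ "m - 1"])
      moreover have "Suc i \<in> ?\<pi> ` {..<m}" if "i < m" for i
      proof (cases "Suc i = m")
        case True
        thus ?thesis using m by (intro image_eqI[of _ _ 0]) auto
      next
        case False
        thus ?thesis using that by (intro image_eqI[of _ _ "Suc i"]) (auto simp: Transposition.transpose_def)
      qed
      ultimately show ?thesis by blast
    qed
    hence "set (take m (permute_list ?\<pi> F)) = (!) F ` Suc ` {..<m}"
      using set_take_permute_list[of ?\<pi> F m] \<pi> len by simp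
    also have "\<dots> = (!) (tl F) ` {..<m}"
      unfolding image_image using len x by (intro image_cong) (auto simp: nth_tl)
    also have "\<dots> = set (take m (tl F))"
      using nth_image[of m "tl F"] len x by (simp add: lessThan_atLeast0)
    finally have "satisfiable (take m (permute_list ?\<pi> F)) = satisfiable (take m (tl F))"
      by (rule satisfiable_cong)
    hence "sat_first (permute_list ?\<pi> F) = of_bool (satisfiable (take m (tl F)))"
      by (simp add: sat_first_def)
    moreover have "pure_at m (permute_list ?\<pi> F) = pure_at 0 F"
      using pure_at_permute[of ?\<pi> F m] \<pi> len x by simp
    ultimately show ?thesis by simp
  qed
  have "correlation = E (\<lambda>F. sat_first F * pure_at 0 F) - E (\<lambda>F. sat_first F * pure_at m F)"
    by (simp add: correlation_def right_diff_distrib mean_diff)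
  also have "E (\<lambda>F. sat_first F * pure_at m F) =
      E (\<lambda>F. sat_first (permute_list ?\<pi> F) * pure_at m (permute_list ?\<pi> F))"
    by (rule mean_permute[OF \<pi>, symmetric])
  also have "E (\<lambda>F. sat_first F * pure_at 0 F) - \<dots> = E (\<lambda>F. sat_drop (tl F) * pure_at 0 F)"
    unfolding mean_diff[symmetric] by (rule mean_cong) (simp only: 1 2 sat_drop_def left_diff_distrib)
  also have "\<dots> = mean s k n N (\<lambda>G. sat_drop G * (card (pure_extensions G) / e))"
    by (rule mean_times_pure_at_0)
  finally show ?thesis .
qed

section \<open>The share of pure extensions and the bound for one step\<close>

lemma card_pure_extensions_le:
  "real (card (pure_extensions G)) \<le> k * card (missing_literals n G) * T / (2 * real n)"
proof -
  have "card (pure_extensions G) \<le> card {C \<in> k_clauses k n. has_pure_literal G C}"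
    unfolding pure_extensions_def using extensions_subset[of s k n G] finite_k_clauses
    by (intro card_mono) auto
  hence "2 * n * card (pure_extensions G) \<le> k * card (missing_literals n G) * card (k_clauses k n)"
    using card_pure_clauses_bounds(2) k(1) by (meson le_trans mult_le_mono2 one_le_numeral)
  hence "2 * real n * card (pure_extensions G) \<le> k * card (missing_literals n G) * T"
    unfolding of_nat_le_iff[symmetric, where ?'a = real] of_nat_mult of_nat_numeral .
  thus ?thesis using k by (simp add: pos_le_divide_eq mult.commute)
qed

lemma card_pure_extensions_ge:
  assumes "G \<in> formulas s k n N"
  shows "real (card (pure_extensions G)) \<ge> card (missing_literals n G) * T / (2 * real n) - N"
proof -
  let ?B = "{C \<in> k_clauses k n. has_pure_literal G C}"
  have "?B - set G \<subseteq> pure_extensions G"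
    unfolding pure_extensions_def by (cases s) auto
  moreover have "finite (pure_extensions G)" by (simp add: pure_extensions_def finite_extensions)
  ultimately have "card (?B - set G) \<le> card (pure_extensions G)" by (rule card_mono[rotated])
  moreover have "card ?B - card (set G) \<le> card (?B - set G)" by (rule diff_card_le_card_Diff) simp
  moreover have "card (set G) \<le> N" using card_length[of G] length_formulas[OF assms] by simp
  ultimately have "real (card ?B) - N \<le> card (pure_extensions G)" by linarith
  moreover have "card (missing_literals n G) * card (k_clauses k n) \<le> 2 * n * card ?B"
    by (rule card_pure_clauses_bounds(1)) (use k in simp)
  hence "card (missing_literals n G) * T \<le> 2 * real n * card ?B"
    unfolding of_nat_le_iff[symmetric, where ?'a = real] of_nat_mult of_nat_numeral .
  hence "card (missing_literals n G) * T / (2 * real n) \<le> card ?B"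
    using k by (simp add: pos_divide_le_eq mult.commute)
  ultimately show ?thesis by linarith
qed

abbreviation "p \<equiv> miss_prob s k n N"

lemma p_pure_le: "p_pure \<le> k * p * T / e"
proof -
  have "p_pure = mean s k n N (\<lambda>G. 1 * (card (pure_extensions G) / e))"
    using mean_times_pure_at_0[of "\<lambda>_. 1"] by (simp add: p_pure_def)
  also have "\<dots> \<le> mean s k n N (\<lambda>G. (k * T / (2 * real n) / e) * card (missing_literals n G))"
  proof (rule mean_mono)
    fix G
    show "1 * (card (pure_extensions G) / e) \<le> (k * T / (2 * real n) / e) * card (missing_literals n G)"
      using divide_right_mono[OF card_pure_extensions_le, of e G] by (simp add: mult_ac)
  qed
  also have "\<dots> = k * p * T / e"
    unfolding mean_cmult using mean_card_missing_literals[OF nonempty_N] k by simp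
  finally show ?thesis .
qed

text \<open>Meant for \<open>N\<close> small compared with \<open>n\<close>, where a clause rarely
  has all its negated literals in the formula.\<close>

lemma one_minus_p_pure_le:
  "1 - p_pure \<le> (k * N)\<^sup>2 * (k * (k - 1)) / (4 * real n * (real n - 1)) * (T / e)"
proof -
  let ?c = "(k * N)\<^sup>2 * (k * (k - 1)) / (4 * real n * (real n - 1)) * (T / e)"
  have "1 - p_pure = mean s k n N (\<lambda>G. 1 - 1 * (card (pure_extensions G) / e))"
    using mean_times_pure_at_0[of "\<lambda>_. 1"]
    unfolding mean_diff mean_const[OF nonempty_N] by (simp add: p_pure_def)
  also have "\<dots> \<le> mean s k n N (\<lambda>G. ?c)"
  proof (rule mean_mono)
    fix G assume G: "G \<in> formulas s k n N"
    let ?A = "{C \<in> extensions s k n G. \<not> has_pure_literal G C}"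
    have "extensions s k n G = pure_extensions G \<union> ?A" by (auto simp: pure_extensions_def)
    hence "num_extensions s k n N = card (pure_extensions G \<union> ?A)"
      using card_extensions[OF G] by simp
    also have "\<dots> = card (pure_extensions G) + card ?A"
      by (rule card_Un_disjoint) (auto simp: pure_extensions_def finite_extensions)
    finally have "1 - 1 * (card (pure_extensions G) / e) = card ?A / e"
      using e_pos by (simp add: field_simps)
    also have "card ?A / e \<le> card {C \<in> k_clauses k n. \<not> has_pure_literal G C} / e"
      using e_pos extensions_subset[of s k n G] finite_k_clauses
      by (intro divide_right_mono of_nat_mono card_mono) auto
    also have "\<dots> \<le> (k * N)\<^sup>2 * (k * (k - 1)) * T / (4 * real n * (real n - 1)) / e"
    proof (rule divide_right_mono)
      let ?a = "card {C \<in> k_clauses k n. \<not> has_pure_literal G C}"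
      have "4 * n * (n - 1) * ?a \<le> ((k * N)\<^sup>2 * (k * (k - 1))) * card (k_clauses k n)"
        using card_impure_clauses_le[OF G k(1)] by (simp only: mult.assoc)
      hence "real (4 * n * (n - 1) * ?a) \<le> real (((k * N)\<^sup>2 * (k * (k - 1))) * card (k_clauses k n))"
        by (simp only: of_nat_le_iff)
      moreover have "real (4 * n * (n - 1) * ?a) = ?a * (4 * real n * (real n - 1))"
        using k by (simp add: of_nat_diff)
      moreover have "4 * real n * (real n - 1) > 0" using k by simp
      ultimately show "?a \<le> (k * N)\<^sup>2 * (k * (k - 1)) * T / (4 * real n * (real n - 1))"
        by (simp only: pos_le_divide_eq of_nat_mult)
    qed simp
    finally show "1 - 1 * (card (pure_extensions G) / e) \<le> ?c" by (simp add: mult_ac)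
  qed
  also have "\<dots> = ?c" by (rule mean_const[OF nonempty_N])
  finally show ?thesis .
qed

text \<open>If at least three quarters of the expected \<open>2 * n * p\<close> literals are
  missing, pure clauses make up \<open>3 / 4 * p\<close> of the pool; clauses already drawn cost at
  most \<open>p / 4\<close>, leaving a share \<open>p / 2\<close> of pure extensions. Dividing the
  correlation bound by \<open>p / 2\<close> gives the first term, and the exceptional formulas the
  second.\<close>

lemma sat_prob_step_le:
  assumes "p > 0" "N \<le> p / 4 * T" "k * T \<le> 2 * real n * e" "v \<ge> p_pure - p_pure2"
  shows "sat_prob s k n (m - 1) - sat_prob s k n m \<le> sqrt ((1 / m + 1 / x) * v) / p + 8 / (n * p)"
proof -
  let ?f = "mean s k n N"
  let ?small = "\<lambda>G. of_bool (card (missing_literals n G) < 3 / 2 * n * p) :: real"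
  have e: "0 < e" "e \<le> T" using e_pos num_extensions_le by auto
  have sat_drop: "0 \<le> sat_drop G" "sat_drop G \<le> 1" for G
    using satisfiable_mono[of "take m G" "take (m - 1) G"] set_take_subset_set_take[of "m - 1" m G]
    by (auto simp: sat_drop_def)
  have "?f sat_drop = sat_prob s k n (m - 1) - sat_prob s k n m"
  proof -
    have N: "m - 1 \<le> N" "m \<le> N" using x by auto
    show ?thesis
      unfolding sat_drop_def mean_diff
      using mean_take[OF nonempty_N N(1), of "\<lambda>F. of_bool (satisfiable F)"]
        mean_take[OF nonempty_N N(2), of "\<lambda>F. of_bool (satisfiable F)"]
        sat_prob_eq_mean[OF formulas_nonempty_le[OF nonempty_N N(1)]]
        sat_prob_eq_mean[OF formulas_nonempty_le[OF nonempty_N N(2)]] by simp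
  qed
  moreover have "?f ?small \<le> 8 / (n * p)"
  proof (rule few_missing_literals_unlikely[OF nonempty_N])
    show "k * card (k_clauses k n) \<le> 2 * n * num_extensions s k n N"
      using assms(3) by (simp only: of_nat_le_iff[symmetric, where ?'a = real]) simp
  qed (use k assms(1) in auto)
  moreover have "p / 2 * (?f sat_drop - ?f ?small) \<le> correlation"
  proof -
    have "p / 2 * (?f sat_drop - ?f ?small) = ?f (\<lambda>G. p / 2 * (sat_drop G - ?small G))"
      by (simp only: mean_cmult mean_diff)
    also have "\<dots> \<le> ?f (\<lambda>G. sat_drop G * (card (pure_extensions G) / e))"
    proof (rule mean_mono)
      fix G assume G: "G \<in> formulas s k n N"
      show "p / 2 * (sat_drop G - ?small G) \<le> sat_drop G * (card (pure_extensions G) / e)"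
      proof (cases "card (missing_literals n G) < 3 / 2 * n * p")
        case True
        \<comment> \<open>On exceptional formulas the subtracted indicator outweighs the drop, which
          is at most \<open>1\<close>.\<close>
        hence "p / 2 * (sat_drop G - ?small G) \<le> 0"
          using sat_drop(2)[of G] assms(1) by (simp add: mult_nonneg_nonpos)
        also have "0 \<le> sat_drop G * (card (pure_extensions G) / e)" using sat_drop(1) by simp
        finally show ?thesis .
      next
        case False
        hence "3 / 4 * p \<le> card (missing_literals n G) / (2 * real n)"
          using k by (simp add: field_simps)
        hence "3 / 4 * p * T \<le> card (missing_literals n G) / (2 * real n) * T"
          by (rule mult_right_mono) simp
        hence "3 / 4 * p * T \<le> card (missing_literals n G) * T / (2 * real n)"
          by (simp only: times_divide_eq_left)
        hence "3 / 4 * p * T - p / 4 * T \<le> card (pure_extensions G)"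
          using card_pure_extensions_ge[OF G] assms(2) by linarith
        moreover have "3 / 4 * p * T - p / 4 * T = p / 2 * T" by (simp add: mult.commute)
        ultimately have "p / 2 * T \<le> card (pure_extensions G)" by (simp only:)
        moreover have "p / 2 * e \<le> p / 2 * T" using e assms(1) by simp
        ultimately have "p / 2 \<le> card (pure_extensions G) / e" using e by (simp add: field_simps)
        hence "sat_drop G * (p / 2) \<le> sat_drop G * (card (pure_extensions G) / e)"
          using sat_drop(1) by (rule mult_left_mono)
        thus ?thesis using False by (simp add: mult.commute)
      qed
    qed
    finally show ?thesis unfolding correlation_eq .
  qed
  hence "?f sat_drop - ?f ?small \<le> correlation / (p / 2)" using assms(1) by (simp add: field_simps)
  moreover have "correlation / (p / 2) \<le> sqrt ((1 / m + 1 / x) * v) / 2 / (p / 2)"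
    using correlation_le[OF assms(4)] assms(1) by (intro divide_right_mono) auto
  ultimately show ?thesis by simp
qed

end

section \<open>Asymptotics\<close>

text \<open>Makes linearly many draws a vanishing share of the pool. The power \<open>k\<close> of
  \<open>2 * n / k\<close> may be lowered to \<open>2\<close> as the base is at least
  \<open>1\<close>.\<close>

lemma card_k_clauses_ge:
  assumes "2 \<le> k" "k \<le> n"
  shows "(2 * real n / k)\<^sup>2 \<le> card (k_clauses k n)"
proof -
  have 1: "1 \<le> 2 * real n / k" using assms by simp
  have "(2 * real n / k)\<^sup>2 \<le> (2 * real n / k) ^ k"
    using assms(1) 1 by (rule power_increasing)
  also have "\<dots> = 2 ^ k * (real n / k) ^ k" by (simp add: power_mult_distrib[symmetric])
  also have "\<dots> \<le> 2 ^ k * real (n choose k)"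
    using binomial_ge_n_over_k_pow_k[OF assms(2), where ?'a = real] by simp
  also have "\<dots> = card (k_clauses k n)" by (simp add: card_k_clauses)
  finally show ?thesis .
qed

lemma eventually_linear_le_card_k_clauses:
  fixes c :: real
  assumes "2 \<le> k" "c > 0"
  shows "\<forall>\<^sub>F n in at_top. real d * real n \<le> c * card (k_clauses k n)"
proof -
  have "\<forall>\<^sub>F n in at_top. real d * real n \<le> c * (2 * real n / k)\<^sup>2"
    using assms by real_asymp
  thus ?thesis using eventually_ge_at_top[of k]
  proof eventually_elim
    case (elim n)
    have "c * (2 * real n / k)\<^sup>2 \<le> c * card (k_clauses k n)"
      using card_k_clauses_ge[OF assms(1) elim(2)] assms(2) by simp
    thus ?case using elim by linarith
  qed
qed

lemma formulas_nonempty: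
  assumes "k \<le> n" "m \<le> card (k_clauses k n)"
  shows "formulas s k n m \<noteq> {}"
  using assms formulas_nonempty_iff[of k n m] card_k_clauses[of k n] by (cases s) auto

text \<open>Every factor of \<open>miss_prob\<close> is at least \<open>q n\<close>, and
  \<open>q n ^ n\<close> tends to \<open>exp (- k / 2)\<close>, which exceeds \<open>c\<close>. So
  each block of \<open>n\<close> draws costs at most a factor \<open>c\<close>; the number
  \<open>j\<close> of blocks is kept variable because \<open>m \<le> n\<close> later allows
  \<open>j = 2\<close>.\<close>

lemma eventually_miss_prob_ge:
  assumes k: "2 \<le> k" and c: "0 < c" "c < exp (- real k / 2)"
  shows "\<forall>\<^sub>F n in at_top. \<forall>s N j. j \<le> d \<longrightarrow> N \<le> j * n \<longrightarrow> c ^ j \<le> miss_prob s k n N"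
proof -
  \<comment> \<open>Chosen so that \<open>d * n = b / n * (2 * n / k)\<^sup>2\<close>: the first
    \<open>d * n\<close> draws use up at most a share \<open>b / n\<close> of the pool. The shift by
    \<open>b\<close> in \<open>q\<close> accounts for this depletion.\<close>
  define b where "b = real d * real k ^ 2 / 4"
  define q where "q n = 1 - real k / (2 * (real n - b))" for n :: nat
  have "(\<lambda>n. q n ^ n) \<longlonglongrightarrow> exp (- real k / 2)"
    unfolding q_def by real_asymp
  hence "\<forall>\<^sub>F n in at_top. c < q n ^ n" using c(2) by (rule order_tendstoD)
  moreover have "\<forall>\<^sub>F n in at_top. real k / 2 + b < real n" by real_asymp
  ultimately show ?thesis using eventually_ge_at_top[of k]
  proof eventually_elim
    case (elim n)
    let ?T = "real (card (k_clauses k n))"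
    have n: "real n > 0" "real n - b > 0" "n \<ge> k" using elim k by auto
    have b: "b \<ge> 0" by (simp add: b_def)
    have q: "0 \<le> q n" "q n \<le> 1" using elim n by (auto simp: q_def field_simps)
    have T: "?T > 0" using n by (simp add: card_k_clauses)
    have dT: "d * real n \<le> b / n * ?T"
    proof -
      have "d * real n = b / n * (2 * real n / k)\<^sup>2"
        using k n by (simp add: b_def field_simps power2_eq_square)
      also have "\<dots> \<le> b / n * ?T"
        using card_k_clauses_ge[OF k n(3)] b by (intro mult_left_mono) auto
      finally show ?thesis .
    qed
    show ?case
    proof (intro allI impI)
      fix s N j assume j: "j \<le> d" "N \<le> j * n"
      have "c ^ j \<le> (q n ^ n) ^ j" using elim c by (intro power_mono) auto
      also have "\<dots> = q n ^ (j * n)" by (simp add: power_mult[symmetric] mult.commute)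
      also have "\<dots> \<le> q n ^ N" using j(2) q by (intro power_decreasing) auto
      also have "\<dots> = (\<Prod>r<N. q n)" by simp
      also have "\<dots> \<le> miss_prob s k n N"
        unfolding miss_prob_def of_nat_mult
      proof (rule prod_mono)
        fix r assume r: "r \<in> {..<N}"
        let ?e = "real (num_extensions s k n r)"
        have "r \<le> d * n" using r j by (metis lessThan_iff less_imp_le le_trans mult_le_mono1)
        hence "real r \<le> real d * real n" by (metis of_nat_le_iff of_nat_mult)
        hence "?T - real r \<ge> ?T - b / n * ?T" using dT by simp
        moreover have "?T - b / n * ?T = ?T * (real n - b) / n" using n by (simp add: field_simps)
        moreover have "?T - real r \<le> ?e" using num_extensions_ge[of k n r s] by linarith
        ultimately have e: "?T * (real n - b) / n \<le> ?e" by linarith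
        have pos: "0 < ?T * (real n - b) / n" using T n by simp
        have "k * ?T / (2 * real n * ?e) \<le> k * ?T / (2 * real n * (?T * (real n - b) / n))"
          using e pos order_less_le_trans[OF pos e] n T by (intro divide_left_mono mult_left_mono mult_pos_pos) auto
        also have "\<dots> = real k / (2 * (real n - b))" using n T by simp
        finally show "0 \<le> q n \<and> q n \<le> 1 - k * ?T / (2 * real n * ?e)"
          using q by (simp add: q_def)
      qed
      finally show "c ^ j \<le> miss_prob s k n N" .
    qed
  qed
qed

text \<open>
  The window is chosen as \<open>x = min m n\<close>. For \<open>m \<le> n\<close> the variance is small because few clauses
  fail to be pure, for \<open>m > n\<close> because few clauses are pure; this gives the two conditions on \<open>\<Lambda>\<close>.
\<close>

lemma eventually_sat_prob_step_le:
  assumes k: "2 \<le> k" and c: "0 < c" "c < exp (- real k / 2)" and d: "1 \<le> d"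
    and \<Lambda>: "3 * (real k)\<^sup>2 / c\<^sup>2 + 1 \<le> \<Lambda>" "sqrt (5 / 2 * k / c ^ (d + 1)) + 1 \<le> \<Lambda>"
  shows "\<forall>\<^sub>F n in at_top. \<forall>s m. 1 \<le> m \<longrightarrow> m \<le> d * n \<longrightarrow>
           sat_prob s k n (m - 1) - sat_prob s k n m \<le> \<Lambda> / sqrt n"
proof -
  \<comment> \<open>A lower bound for \<open>p\<close>, since the window spans at most
    \<open>d + 1\<close> blocks of \<open>n\<close> draws.\<close>
  define c' where "c' = c ^ (d + 1)"
  have c': "0 < c'" using c by (simp add: c'_def)
  have "c < 1" using c(2) by (rule less_le_trans) simp
  \<comment> \<open>The contribution of the exceptional formulas; the summand \<open>1\<close> in
    both conditions on \<open>\<Lambda>\<close> pays for it.\<close>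
  have "\<forall>\<^sub>F n in at_top. 8 / (real n * c') \<le> 1 / sqrt n" using c' by real_asymp
  \<comment> \<open>The factor \<open>1 / 5\<close> yields \<open>?T / e \<le> 5 / 4\<close>, and
    \<open>c' / 4\<close> yields the hypothesis \<open>N \<le> p / 4 * T\<close> of
    \<open>sat_prob_step_le\<close>.\<close>
  moreover have "\<forall>\<^sub>F n in at_top. real (d + 1) * real n \<le> min (1 / 5) (c' / 4) * card (k_clauses k n)"
    by (rule eventually_linear_le_card_k_clauses[OF k]) (use c' in simp)
  moreover note eventually_miss_prob_ge[OF k c, of "d + 1"] eventually_ge_at_top[of k]
  ultimately show ?thesis
  proof eventually_elim
    case (elim n)
    let ?T = "real (card (k_clauses k n))"
    have n: "real n > 0" "n \<ge> 2" using elim(4) k by auto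
    have T: "?T > 0" using elim(4) by (simp add: card_k_clauses)
    have dn: "real (d + 1) * real n \<le> 1 / 5 * ?T" "real (d + 1) * real n \<le> c' / 4 * ?T"
      by (rule order_trans[OF elim(2) mult_right_mono]; simp)+
    show ?case
    proof (intro allI impI)
      fix s m assume m: "1 \<le> m" "m \<le> d * n"
      define x where "x = min m n"
      have x: "1 \<le> x" "x \<le> n" using m n by (auto simp: x_def)
      have M: "m + x \<le> (d + 1) * n" using m x by simp
      hence "real (m + x) \<le> real ((d + 1) * n)" by (rule of_nat_mono)
      hence M': "real (m + x) \<le> real (d + 1) * real n" by (simp only: of_nat_mult)
      hence "m + x \<le> card (k_clauses k n)" using dn T by linarith
      hence nonempty: "formulas s k n (m + x) \<noteq> {}" by (rule formulas_nonempty[OF elim(4)])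
      interpret sat_window s k n m x
        by unfold_locales (use k elim(4) m x nonempty in auto)
      have N: "real N \<le> real (d + 1) * real n" using M' by linarith
      have e: "4 / 5 * ?T \<le> e"
        using num_extensions_ge[of k n N s] N dn by linarith
      have Te: "?T / e \<le> 5 / 4" using e e_pos by (simp add: field_simps)
      have "c' \<le> p" unfolding c'_def using elim(3) M by (metis diff_le_self le_refl le_trans)
      hence p: "p > 0" "c' \<le> p" using c' by auto
      have 1: "N \<le> p / 4 * ?T"
      proof -
        have "real N \<le> c' / 4 * ?T" using N dn by linarith
        also have "\<dots> \<le> p / 4 * ?T" using p by (intro mult_right_mono) auto
        finally show ?thesis .
      qed
      have 2: "k * ?T \<le> 2 * real n * e"
      proof -
        have "k * ?T \<le> real n * ?T" using elim(4) by (intro mult_right_mono) auto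
        also have "\<dots> \<le> real n * (2 * e)" using e T n by (intro mult_left_mono) auto
        finally show ?thesis by simp
      qed
      have small: "8 / (n * p) \<le> 1 / sqrt n"
      proof -
        have "8 / (n * p) \<le> 8 / (n * c')" using p n c' by (intro divide_left_mono) auto
        thus ?thesis using elim(1) by linarith
      qed
      have "\<exists>v \<ge> p_pure - p_pure2. sqrt ((1 / m + 1 / x) * v) / p \<le> (\<Lambda> - 1) / sqrt n"
      proof (cases "m \<le> n")
        case True
        hence xm: "x = m" by (simp add: x_def)
        have cp: "c\<^sup>2 \<le> p" using elim(3)[rule_format, of 2 N] d True xm by simp
        \<comment> \<open>From \<open>one_minus_p_pure_le\<close> with \<open>N \<le> 2 * m\<close>,
          \<open>4 * n * (n - 1) \<ge> 2 * n\<^sup>2\<close> and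
          \<open>T / e \<le> 5 / 4\<close>.\<close>
        define v where "v = 5 / 2 * real k ^ 4 * (m / n)\<^sup>2"
        have "1 - p_pure \<le> v"
        proof -
          have "real ((k * N)\<^sup>2 * (k * (k - 1))) \<le> real ((k * (2 * m))\<^sup>2 * (k * k))"
            using xm by (intro of_nat_mono mult_le_mono power_mono) auto
          also have "\<dots> = 4 * real k ^ 4 * real m ^ 2"
            by (simp add: power2_eq_square power4_eq_xxxx)
          finally have num: "real ((k * N)\<^sup>2 * (k * (k - 1))) \<le> 4 * real k ^ 4 * real m ^ 2" .
          have "real n * 2 \<le> real n * n" using n by (intro mult_left_mono) auto
          hence den: "2 * (real n)\<^sup>2 \<le> 4 * real n * (real n - 1)"
            by (simp add: power2_eq_square algebra_simps)
          have "real ((k * N)\<^sup>2 * (k * (k - 1))) / (4 * real n * (real n - 1)) \<le>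
              4 * real k ^ 4 * real m ^ 2 / (2 * (real n)\<^sup>2)"
            using num den n by (intro frac_le) auto
          hence "real ((k * N)\<^sup>2 * (k * (k - 1))) / (4 * real n * (real n - 1)) * (?T / e) \<le>
              4 * real k ^ 4 * real m ^ 2 / (2 * (real n)\<^sup>2) * (5 / 4)"
            using Te e_pos T by (intro mult_mono) auto
          also have "\<dots> = v" by (simp add: v_def power_divide)
          finally show ?thesis using one_minus_p_pure_le by linarith
        qed
        hence v: "v \<ge> p_pure - p_pure2" using p_pure_variance_le(2) by linarith
        have "(1 / m + 1 / x) * v = 5 * real k ^ 4 * (m / n) * (1 / n)"
          using m n xm by (simp add: v_def power2_eq_square)
        \<comment> \<open>The factor \<open>5\<close> is rounded up to the square \<open>9\<close>,
          and \<open>m / n\<close> is at most \<open>1\<close>.\<close>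
        also have "\<dots> \<le> 9 * real k ^ 4 * 1 * (1 / n)"
          using True n by (intro mult_right_mono mult_mono) auto
        also have "\<dots> = (3 * (real k)\<^sup>2 / sqrt n)\<^sup>2"
          by (simp add: power_divide power_mult_distrib)
        finally have "sqrt ((1 / m + 1 / x) * v) \<le> 3 * (real k)\<^sup>2 / sqrt n"
          by (rule real_le_lsqrt[rotated]) simp
        hence "sqrt ((1 / m + 1 / x) * v) / p \<le> 3 * (real k)\<^sup>2 / sqrt n / c\<^sup>2"
          using cp c(1) by (intro frac_le) auto
        also have "\<dots> = 3 * (real k)\<^sup>2 / c\<^sup>2 / sqrt n" by simp
        also have "\<dots> \<le> (\<Lambda> - 1) / sqrt n" using \<Lambda>(1) by (intro divide_right_mono) auto
        finally show ?thesis using v by blast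
      next
        case False
        hence xn: "x = n" by (simp add: x_def)
        \<comment> \<open>Proportional to \<open>p\<close>, so that after the square root the
          division by \<open>p\<close> leaves only \<open>1 / sqrt p\<close>, bounded through
          \<open>c'\<close>.\<close>
        define v where "v = 5 / 4 * real k * p"
        have "p_pure \<le> v"
        proof -
          have "k * p * ?T / e = k * p * (?T / e)" by simp
          also have "\<dots> \<le> k * p * (5 / 4)" using Te p by (intro mult_left_mono) auto
          also have "\<dots> = v" by (simp add: v_def)
          finally show ?thesis using p_pure_le by linarith
        qed
        hence v: "v \<ge> p_pure - p_pure2" using p_pure_variance_le(1) by linarith
        have "1 / real m \<le> 1 / n" using False n by (intro divide_left_mono) auto
        hence "(1 / m + 1 / x) * v \<le> 2 / n * v"
          using xn p by (intro mult_right_mono) (auto simp: v_def)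
        also have "\<dots> = p\<^sup>2 * (5 / 2 * k / p / n)"
          using p by (simp add: v_def power2_eq_square)
        also have "\<dots> \<le> p\<^sup>2 * (5 / 2 * k / c' / n)"
          using p c' by (intro mult_left_mono divide_right_mono divide_left_mono) auto
        finally have "sqrt ((1 / m + 1 / x) * v) \<le> sqrt (p\<^sup>2 * (5 / 2 * k / c' / n))"
          by (rule real_sqrt_le_mono)
        also have "\<dots> = p * (sqrt (5 / 2 * k / c') / sqrt n)"
          using p by (simp add: real_sqrt_mult real_sqrt_divide)
        finally have "sqrt ((1 / m + 1 / x) * v) / p \<le> sqrt (5 / 2 * k / c') / sqrt n"
          using p by (simp add: pos_divide_le_eq mult.commute)
        also have "\<dots> \<le> (\<Lambda> - 1) / sqrt n" using \<Lambda>(2) by (intro divide_right_mono) (auto simp: c'_def)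
        finally show ?thesis using v by blast
      qed
      then obtain v where v: "v \<ge> p_pure - p_pure2"
          "sqrt ((1 / m + 1 / x) * v) / p \<le> (\<Lambda> - 1) / sqrt n" by blast
      have "sat_prob s k n (m - 1) - sat_prob s k n m \<le> (\<Lambda> - 1) / sqrt n + 1 / sqrt n"
        using sat_prob_step_le[OF p(1) 1 2 v(1)] v(2) small by linarith
      also have "\<dots> = \<Lambda> / sqrt n" by (simp add: diff_divide_distrib)
      finally show "sat_prob s k n (m - 1) - sat_prob s k n m \<le> \<Lambda> / sqrt n" .
    qed
  qed
qed

lemma eventually_sat_prob_small:
  assumes "2 \<le> k" "2 * (1 - 1 / 2 ^ k :: real) ^ d < 1" "\<delta> > 0"
  shows "\<forall>\<^sub>F n in at_top. \<forall>s. formulas s k n (d * n) \<noteq> {} \<and> sat_prob s k n (d * n) < \<delta>"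
proof -
  let ?q = "2 * (1 - 1 / 2 ^ k :: real) ^ d"
  have "0 \<le> (1 - 1 / 2 ^ k :: real)" using one_le_power[of "2::real" k] by simp
  hence "0 \<le> ?q" by simp
  hence "(\<lambda>n. ?q ^ n) \<longlonglongrightarrow> 0" using assms(2) by (intro LIMSEQ_realpow_zero)
  hence "\<forall>\<^sub>F n in at_top. ?q ^ n < \<delta>" using assms(3) by (rule order_tendstoD)
  moreover have "\<forall>\<^sub>F n in at_top. real d * real n \<le> 1 * real (card (k_clauses k n))"
    by (rule eventually_linear_le_card_k_clauses[OF assms(1)]) simp
  ultimately show ?thesis using eventually_ge_at_top[of k]
  proof eventually_elim
    case (elim n)
    show ?case
    proof
      fix s
      have "d * n \<le> card (k_clauses k n)"
        using elim(2) by (simp only: mult_1 of_nat_mult[symmetric] of_nat_le_iff)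
      hence ne: "formulas s k n (d * n) \<noteq> {}" using elim(3) by (intro formulas_nonempty) simp_all
      have "sat_prob s k n (d * n) \<le> ?q ^ n"
        using sat_prob_le_first_moment[OF ne elim(3)] by (simp add: power_mult power_mult_distrib)
      thus "formulas s k n (d * n) \<noteq> {} \<and> sat_prob s k n (d * n) < \<delta>" using ne elim(1) by simp
    qed
  qed
qed

section \<open>From single steps to the transition window\<close>

lemma sat_prob_diff_le:
  assumes "\<And>m. 1 \<le> m \<Longrightarrow> m \<le> b \<Longrightarrow> sat_prob s k n (m - 1) - sat_prob s k n m \<le> \<delta>"
    and "i \<le> j" "j \<le> b"
  shows "sat_prob s k n i - sat_prob s k n j \<le> (real j - real i) * \<delta>"
  using assms(2,3)
proof (induction j rule: dec_induct)
  case (step j)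
  have "sat_prob s k n j - sat_prob s k n (Suc j) \<le> \<delta>"
    using assms(1)[of "Suc j"] step.prems by simp
  thus ?case using step by (simp add: algebra_simps)
qed simp

text \<open>The constant \<open>a\<close> is fixed ahead of the sampling mode and the levels
  \<open>p1\<close> and \<open>p2\<close>, so it can depend on \<open>k\<close> only.\<close>

definition window_bound :: "nat \<Rightarrow> real \<Rightarrow> bool" where
  "window_bound k a \<longleftrightarrow> (\<forall>s p1 p2 m1 m2. p1 > p2 \<and> p2 > 0 \<and>
     (\<forall>\<^sub>F n in at_top. formulas s k n (m1 n) \<noteq> {} \<and> sat_prob s k n (m1 n) \<ge> p1) \<and>
     (\<forall>\<^sub>F n in at_top. formulas s k n (m2 n) \<noteq> {} \<and> sat_prob s k n (m2 n) \<le> p2) \<longrightarrow>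
     (\<forall>\<^sub>F n in at_top. real (m2 n) - real (m1 n) \<ge> a * (p1 - p2) * sqrt n))"

lemma window_boundI:
  assumes k: "2 \<le> k" and c: "0 < c" "c < exp (- real k / 2)" and d: "1 \<le> d"
    and \<Lambda>: "3 * (real k)\<^sup>2 / c\<^sup>2 + 1 \<le> \<Lambda>" "sqrt (5 / 2 * k / c ^ (d + 1)) + 1 \<le> \<Lambda>"
    and d': "2 * (1 - 1 / 2 ^ k :: real) ^ d < 1"
  shows "window_bound k (1 / \<Lambda>)"
  unfolding window_bound_def
proof (intro allI impI, elim conjE)
  fix s p1 p2 m1 m2
  assume p: "p1 > p2" "p2 > (0::real)"
    and m1: "\<forall>\<^sub>F n in at_top. formulas s k n (m1 n) \<noteq> {} \<and> sat_prob s k n (m1 n) \<ge> p1"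
    and m2: "\<forall>\<^sub>F n in at_top. formulas s k n (m2 n) \<noteq> {} \<and> sat_prob s k n (m2 n) \<le> p2"
  have "0 \<le> sqrt (5 / 2 * k / c ^ (d + 1))" using c by simp
  hence \<Lambda>0: "\<Lambda> > 0" using \<Lambda>(2) by linarith
  from m1 m2 eventually_sat_prob_step_le[OF k c d \<Lambda>] eventually_sat_prob_small[OF k d' p(2)]
    eventually_gt_at_top[of 0]
  show "\<forall>\<^sub>F n in at_top. real (m2 n) - real (m1 n) \<ge> 1 / \<Lambda> * (p1 - p2) * sqrt n"
  proof eventually_elim
    case (elim n)
    \<comment> \<open>The step bound reaches only up to \<open>d * n\<close> clauses, where the
      probability is already below \<open>p2\<close>; so \<open>m2 n\<close> may be cut off
      there.\<close>
    let ?f = "sat_prob s k n" and ?j = "min (m2 n) (d * n)"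
    have j: "?f ?j \<le> p2" "formulas s k n ?j \<noteq> {}"
      using elim(2) elim(4)[rule_format, of s] by (auto simp: min_def)
    \<comment> \<open>Otherwise monotonicity would give \<open>p1 \<le> p2\<close>.\<close>
    have "m1 n \<le> ?j"
    proof (rule ccontr)
      assume "\<not> m1 n \<le> ?j"
      hence "?f (m1 n) \<le> ?f ?j" using elim(1) by (intro sat_prob_antimono) auto
      thus False using elim(1) j p by linarith
    qed
    hence "?f (m1 n) - ?f ?j \<le> (real ?j - real (m1 n)) * (\<Lambda> / sqrt n)"
      using elim(3) by (intro sat_prob_diff_le[where b = "d * n"]) auto
    hence "p1 - p2 \<le> (real ?j - real (m1 n)) * (\<Lambda> / sqrt n)" using elim(1) j by linarith
    hence "(p1 - p2) * sqrt n \<le> (real ?j - real (m1 n)) * \<Lambda>"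
      using elim(5) by (simp add: pos_le_divide_eq)
    hence "1 / \<Lambda> * (p1 - p2) * sqrt n \<le> real ?j - real (m1 n)"
      using \<Lambda>0 by (simp add: pos_divide_le_eq)
    thus ?case by linarith
  qed
qed

text \<open>\<open>666\<close> is the largest integer below \<open>1 / 0.0015\<close>,
  \<open>d = 6\<close> the least exponent with \<open>2 * (7 / 8) ^ d < 1\<close>, and
  \<open>0.22\<close> lies just below \<open>exp (- 3 / 2)\<close>, about
  \<open>0.2231\<close>.\<close>

lemma window_bound_3: "window_bound 3 (1 / 666)"
proof (rule window_boundI[where c = "0.22" and d = 6])
  \<comment> \<open>Squaring turns the comparison into one between the cube of \<open>exp 1\<close>
    and a rational, settled by \<open>exp 1 < 2.72\<close>.\<close>
  have "exp (3 / 2 :: real) ^ 2 = exp 1 ^ 3"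
    by (simp add: exp_of_nat_mult[symmetric])
  also have "\<dots> < (272 / 100) ^ 3"
    using e_less_272 by (intro power_strict_mono) auto
  also have "\<dots> < (1 / 0.22 :: real) ^ 2" by (simp add: power_divide)
  finally have "exp (3 / 2 :: real) < 1 / 0.22" by (rule power_less_imp_less_base) simp
  thus "(0.22::real) < exp (- real 3 / 2)" by (simp add: exp_minus field_simps)
  show "sqrt (5 / 2 * real 3 / 0.22 ^ (6 + 1)) + 1 \<le> 666"
  proof -
    have "sqrt (5 / 2 * real 3 / 0.22 ^ (6 + 1)) \<le> 665"
      by (rule real_le_lsqrt) (simp_all add: power_divide)
    thus ?thesis by simp
  qed
qed (simp_all add: power_divide)

text \<open>\<open>d = 2 ^ k\<close> works for the first moment bound because
  \<open>(1 - 1 / d) ^ d \<le> exp (-1) < 1 / 2\<close>; \<open>\<Lambda>\<close> is then read off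
  from its two conditions.\<close>

lemma ex_window_bound:
  assumes "2 \<le> k"
  shows "\<exists>a>0. window_bound k a"
proof -
  define c where "c = exp (- real k / 2) / 2"
  have c: "0 < c" "c < exp (- real k / 2)" by (simp_all add: c_def)
  define \<Lambda> where "\<Lambda> = max (3 * (real k)\<^sup>2 / c\<^sup>2) (sqrt (5 / 2 * k / c ^ (2 ^ k + 1))) + 1"
  have "window_bound k (1 / \<Lambda>)"
  proof (rule window_boundI[OF assms c, where d = "2 ^ k"])
    have "(1 - 1 / 2 ^ k :: real) ^ 2 ^ k \<le> exp (- 1 / 2 ^ k) ^ 2 ^ k"
      using exp_ge_add_one_self[of "- 1 / 2 ^ k"] one_le_power[of "2::real" k]
      by (intro power_mono) (simp_all add: divide_simps)
    also have "\<dots> = exp (-1)" by (simp add: exp_of_nat_mult[symmetric])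
    also have "\<dots> < 1 / 2"
      using exp_lower_Taylor_quadratic[of 1] by (simp add: exp_minus field_simps)
    finally show "2 * (1 - 1 / 2 ^ k :: real) ^ 2 ^ k < 1" by simp
  qed (simp_all add: \<Lambda>_def)
  moreover have "\<Lambda> > 0" unfolding \<Lambda>_def by (intro add_nonneg_pos) (auto simp: le_max_iff_disj)
  ultimately show ?thesis by (intro exI[of _ "1 / \<Lambda>"]) simp
qed

section \<open>Thresholds and the critical exponent\<close>

lemma ex_first_moment_density: "\<exists>d. 2 * (1 - 1 / 2 ^ k :: real) ^ d < 1"
proof -
  have "(1 - 1 / 2 ^ k :: real) < 1" "0 \<le> (1 - 1 / 2 ^ k :: real)" by simp_all
  then obtain d where "(1 - 1 / 2 ^ k :: real) ^ d < 1 / 2"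
    using real_arch_pow_inv[of "1 / 2" "1 - 1 / 2 ^ k"] by auto
  thus ?thesis by (intro exI[of _ d]) simp
qed

text \<open>The witness \<open>b\<close> makes the \<open>LEAST\<close> meaningful. As the empty
  formula is satisfiable, \<open>r < 1\<close> keeps the threshold positive, so its predecessor is a
  genuine number of clauses.\<close>

lemma threshold_properties:
  assumes "formulas s k n b \<noteq> {}" "sat_prob s k n b \<le> r" "r < 1"
  shows "formulas s k n (threshold s k r n) \<noteq> {}" "sat_prob s k n (threshold s k r n) \<le> r"
    and "threshold s k r n \<le> b" "threshold s k r n \<ge> 1"
    and "formulas s k n (threshold s k r n - 1) \<noteq> {}" "sat_prob s k n (threshold s k r n - 1) > r"
proof -
  let ?P = "\<lambda>m. formulas s k n m \<noteq> {} \<and> sat_prob s k n m \<le> r"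
  let ?t = "threshold s k r n"
  have b: "?P b" using assms by simp
  have t: "?P ?t" unfolding threshold_def using b by (rule LeastI)
  thus "formulas s k n ?t \<noteq> {}" "sat_prob s k n ?t \<le> r" by auto
  show "?t \<le> b" unfolding threshold_def using b by (rule Least_le)
  have "?t \<noteq> 0"
  proof
    assume "?t = 0"
    thus False using t sat_prob_0[of s k n] assms(3) by simp
  qed
  thus ge: "?t \<ge> 1" by simp
  show ne: "formulas s k n (?t - 1) \<noteq> {}" using formulas_nonempty_le t by (metis diff_le_self)
  have "\<not> ?P (?t - 1)"
    by (rule not_less_Least[of "?t - 1" ?P, folded threshold_def]) (use ge in simp)
  thus "sat_prob s k n (?t - 1) > r" using ne by simp
qed

text \<open>The width is at least of order \<open>sqrt n\<close> and at most linear, so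
  \<open>1 - 1 / \<nu>\<close> lies between \<open>1 / 2\<close> and \<open>1\<close>. The upper end
  excludes negative \<open>\<nu>\<close>.\<close>

lemma critical_exponent_ge_2:
  assumes k: "2 \<le> k" and crit: "is_critical_exponent s k \<nu>"
  shows "\<nu> \<ge> 2"
proof -
  obtain a where a: "a > 0" "window_bound k a" using ex_window_bound[OF k] by blast
  obtain d where d: "2 * (1 - 1 / 2 ^ k :: real) ^ d < 1" using ex_first_moment_density by blast
  define \<alpha> where "\<alpha> = 1 - 1 / \<nu>"
  \<comment> \<open>The single value \<open>1 / 4\<close> for the level is enough, with thresholds
    at \<open>1 / 4\<close> and \<open>3 / 4\<close>.\<close>
  let ?w = "transition_width s k (1 / 4)"
  let ?t = "\<lambda>n. threshold s k (1 / 4) n" and ?u = "\<lambda>n. threshold s k (3 / 4) n"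
  have \<nu>: "\<nu> \<noteq> 0" and w: "?w \<in> \<Theta>(\<lambda>n. real n powr \<alpha>)"
    using crit unfolding is_critical_exponent_def \<alpha>_def by auto
  have w_eq: "?w n = real (?t n) - real (?u n)" for n by (simp add: transition_width_def)
  have ev: "\<forall>\<^sub>F n in at_top. formulas s k n (d * n) \<noteq> {} \<and> sat_prob s k n (d * n) < 1 / 4"
    using eventually_sat_prob_small[OF k d, of "1 / 4"] by (auto elim: eventually_mono)
  \<comment> \<open>The lower clause number is \<open>?u n - 1\<close>: at \<open>?u n\<close>
    itself the probability may already be below \<open>3 / 4\<close>.\<close>
  have "\<forall>\<^sub>F n in at_top. real (?t n) - real (?u n - 1) \<ge> a * (3 / 4 - 1 / 4) * sqrt n"
  proof (rule a(2)[unfolded window_bound_def, rule_format], intro conjI)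
    show "\<forall>\<^sub>F n in at_top. formulas s k n (?u n - 1) \<noteq> {} \<and> sat_prob s k n (?u n - 1) \<ge> 3 / 4"
    proof (rule eventually_mono[OF ev])
      fix n assume n: "formulas s k n (d * n) \<noteq> {} \<and> sat_prob s k n (d * n) < 1 / 4"
      show "formulas s k n (?u n - 1) \<noteq> {} \<and> sat_prob s k n (?u n - 1) \<ge> 3 / 4"
        using threshold_properties(5,6)[of s k n "d * n" "3 / 4"] n by simp
    qed
    show "\<forall>\<^sub>F n in at_top. formulas s k n (?t n) \<noteq> {} \<and> sat_prob s k n (?t n) \<le> 1 / 4"
    proof (rule eventually_mono[OF ev])
      fix n assume n: "formulas s k n (d * n) \<noteq> {} \<and> sat_prob s k n (d * n) < 1 / 4"
      show "formulas s k n (?t n) \<noteq> {} \<and> sat_prob s k n (?t n) \<le> 1 / 4"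
        using threshold_properties(1,2)[of s k n "d * n" "1 / 4"] n by simp
    qed
  qed simp_all
  \<comment> \<open>Half of the bound \<open>a / 2 * sqrt n\<close> absorbs the \<open>1\<close>
    lost by passing to the predecessor.\<close>
  moreover have "\<forall>\<^sub>F n in at_top. 1 \<le> a / 4 * sqrt (real n)" using a(1) by real_asymp
  ultimately have "\<forall>\<^sub>F n in at_top. a / 4 * sqrt n \<le> ?w n"
    by eventually_elim (auto simp: w_eq)
  hence "(\<lambda>n. sqrt (real n)) \<in> O(?w)"
    using a(1) by (intro bigoI[of _ "4 / a"]) (auto elim!: eventually_mono simp: field_simps)
  hence "(\<lambda>n. sqrt (real n)) \<in> O(\<lambda>n. real n powr \<alpha>)"
    by (rule landau_o.big.trans[OF _ bigthetaD1[OF w]])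
  moreover have "(\<lambda>n. sqrt (real n)) = (\<lambda>n. real n powr (1 / 2))" by (simp add: powr_half_sqrt)
  ultimately have lower: "1 / 2 \<le> \<alpha>"
    using powr_bigo_iff[OF filterlim_real_sequentially sequentially_bot] by simp
  \<comment> \<open>Both thresholds are at most \<open>d * n\<close> by the first moment
    bound.\<close>
  have "\<forall>\<^sub>F n in at_top. \<bar>?w n\<bar> \<le> d * real n"
    using ev
  proof eventually_elim
    case (elim n)
    have "?t n \<le> d * n" "?u n \<le> d * n"
      using threshold_properties(3)[of s k n "d * n"] elim by auto
    hence "real (?t n) \<le> d * real n" "real (?u n) \<le> d * real n"
      by (metis of_nat_le_iff of_nat_mult)+
    thus ?case by (auto simp: w_eq abs_if)
  qed
  hence "?w \<in> O(\<lambda>n. real n)" by (intro bigoI[of _ d]) auto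
  hence "(\<lambda>n. real n powr \<alpha>) \<in> O(\<lambda>n. real n)"
    by (rule landau_o.big.trans[OF bigthetaD2[OF w, unfolded bigomega_iff_bigo]])
  hence "(\<lambda>n. real n powr \<alpha>) \<in> O(\<lambda>n. real n powr 1)" by simp
  hence upper: "\<alpha> \<le> 1"
    using powr_bigo_iff[OF filterlim_real_sequentially sequentially_bot] by blast
  have "1 / \<nu> \<ge> 0" "1 / \<nu> \<le> 1 / 2" using lower upper by (simp_all add: \<alpha>_def)
  hence "\<nu> > 0" using \<nu> by simp
  thus ?thesis using \<open>1 / \<nu> \<le> 1 / 2\<close> by (simp add: field_simps)
qed

theorem corollary4:
  shows
   "(\<forall>(s :: sampling) (p1 :: real) (p2 :: real) (m1 :: nat \<Rightarrow> nat) (m2 :: nat \<Rightarrow> nat).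
       1 > p1 \<and> p1 > p2 \<and> p2 > 0 \<and>
       (\<forall>\<^sub>F n in at_top. formulas s 3 n (m1 n) \<noteq> {} \<and> sat_prob s 3 n (m1 n) \<ge> p1) \<and>
       (\<forall>\<^sub>F n in at_top. formulas s 3 n (m2 n) \<noteq> {} \<and> sat_prob s 3 n (m2 n) \<le> p2)
       \<longrightarrow> (\<exists>e :: nat \<Rightarrow> real. e \<in> o(\<lambda>_. 1) \<and>
             (\<forall>\<^sub>F n in at_top.
                real (m2 n) - real (m1 n) \<ge> (0.0015 + e n) * (p1 - p2) * sqrt (real n))))
    \<and> (\<forall>(s :: sampling) (\<nu> :: real). is_critical_exponent s 3 \<nu> \<longrightarrow> \<nu> \<ge> 2)
    \<and> (\<forall>k\<ge>2. \<exists>a :: real. a > 0 \<and>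
         (\<forall>(s :: sampling) (p1 :: real) (p2 :: real) (m1 :: nat \<Rightarrow> nat) (m2 :: nat \<Rightarrow> nat).
            1 > p1 \<and> p1 > p2 \<and> p2 > 0 \<and>
            (\<forall>\<^sub>F n in at_top. formulas s k n (m1 n) \<noteq> {} \<and> sat_prob s k n (m1 n) \<ge> p1) \<and>
            (\<forall>\<^sub>F n in at_top. formulas s k n (m2 n) \<noteq> {} \<and> sat_prob s k n (m2 n) \<le> p2)
            \<longrightarrow> (\<forall>\<^sub>F n in at_top.
                  real (m2 n) - real (m1 n) \<ge> a * (p1 - p2) * sqrt (real n))))
    \<and> (\<forall>k\<ge>2. \<forall>(s :: sampling) (\<nu> :: real). is_critical_exponent s k \<nu> \<longrightarrow> \<nu> \<ge> 2)"
proof (intro conjI allI impI)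
  fix s :: sampling and p1 p2 :: real and m1 m2 :: "nat \<Rightarrow> nat"
  assume *: "1 > p1 \<and> p1 > p2 \<and> p2 > 0 \<and>
    (\<forall>\<^sub>F n in at_top. formulas s 3 n (m1 n) \<noteq> {} \<and> sat_prob s 3 n (m1 n) \<ge> p1) \<and>
    (\<forall>\<^sub>F n in at_top. formulas s 3 n (m2 n) \<noteq> {} \<and> sat_prob s 3 n (m2 n) \<le> p2)"
  hence "\<forall>\<^sub>F n in at_top. real (m2 n) - real (m1 n) \<ge> 1 / 666 * (p1 - p2) * sqrt n"
    by (intro window_bound_3[unfolded window_bound_def, rule_format]) auto
  \<comment> \<open>As \<open>1 / 666\<close> exceeds \<open>0.0015\<close>, the error function can
    be taken to be zero.\<close>
  hence "\<forall>\<^sub>F n in at_top. real (m2 n) - real (m1 n) \<ge> (0.0015 + 0) * (p1 - p2) * sqrt n"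
  proof (rule eventually_mono)
    fix n
    assume "real (m2 n) - real (m1 n) \<ge> 1 / 666 * (p1 - p2) * sqrt n"
    moreover have "(0.0015 + 0) * (p1 - p2) * sqrt n \<le> 1 / 666 * (p1 - p2) * sqrt n"
      using * by (intro mult_right_mono) auto
    ultimately show "real (m2 n) - real (m1 n) \<ge> (0.0015 + 0) * (p1 - p2) * sqrt n" by linarith
  qed
  thus "\<exists>e :: nat \<Rightarrow> real. e \<in> o(\<lambda>_. 1) \<and>
      (\<forall>\<^sub>F n in at_top. real (m2 n) - real (m1 n) \<ge> (0.0015 + e n) * (p1 - p2) * sqrt n)"
    by (intro exI[of _ "\<lambda>_. 0"]) auto
next
  fix k :: nat assume "k \<ge> 2"
  then obtain a where "a > 0" "window_bound k a" using ex_window_bound by blast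
  thus "\<exists>a :: real. a > 0 \<and>
      (\<forall>(s :: sampling) (p1 :: real) (p2 :: real) (m1 :: nat \<Rightarrow> nat) (m2 :: nat \<Rightarrow> nat).
         1 > p1 \<and> p1 > p2 \<and> p2 > 0 \<and>
         (\<forall>\<^sub>F n in at_top. formulas s k n (m1 n) \<noteq> {} \<and> sat_prob s k n (m1 n) \<ge> p1) \<and>
         (\<forall>\<^sub>F n in at_top. formulas s k n (m2 n) \<noteq> {} \<and> sat_prob s k n (m2 n) \<le> p2)
         \<longrightarrow> (\<forall>\<^sub>F n in at_top. real (m2 n) - real (m1 n) \<ge> a * (p1 - p2) * sqrt (real n)))"
    unfolding window_bound_def by blast
next
  fix s \<nu> assume "is_critical_exponent s 3 \<nu>"
  thus "\<nu> \<ge> 2" by (rule critical_exponent_ge_2[rotated]) simp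
qed (rule critical_exponent_ge_2)

end
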